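(* Let $\Gamma$ be the star graph of a non-redundant cyclic presentation $P_n(w)$ where $w\in F_n$ is cyclically reduced and is not a proper power. Define multisets of integers in $\{0,\ldots,n-1\}$, with one entry for each occurrence of a length-two cyclic subword of $w$ of the indicated form (subscripts mod $n$): $\mathcal{A}$ consists of the $a$ for subwords $x_ix_{i+a}^{-1}$; $\mathcal{B}$ of the $b$ for subwords $x_i^{-1}x_{i+b}$; $\mathcal{Q}$ of the $q$ for subwords $x_ix_{i+q}$ or $x_{i+q}^{-1}x_i^{-1}$. Let $d_{\mathcal{A}}=\gcd(n,a\ (a\in\mathcal{A}))$, $d_{\mathcal{B}}=\gcd(n,b\ (b\in\mathcal{B}))$, and if $w$ is non-alternating let $q_0\in\mathcal{Q}$ and set $d=\gcd(n,\ a\ (a\in\mathcal{A}),\ b\ (b\in\mathcal{B}),\ q-q_0\ (q\in\mathcal{Q}))$. Then $\Gamma$ is $l(w)$-regular (degrees counted with edge multiplicity) and has vertices $x_i,x_i^{-1}$ ($0\leq i<n$) and edges $x_i-x_{i+a}$, $x_i^{-1}-x_{i+b}^{-1}$, $x_i-x_{i+q}^{-1}$ for all $a\in\mathcal{A}$, $b\in\mathcal{B}$, $q\in\mathcal{Q}$, $0\leq i<n$. (a) If $w$ is non-alternating then $\Gamma$ has $d$ isomorphic connected components $\Gamma_0,\ldots,\Gamma_{d-1}$, where for $0\leq j<d$ the graph $\Gamma_j$ is the induced labelled subgraph of $\Gamma$ with vertex set $V(\Gamma_j)=V(\Gamma_j^+)\cup V(\Gamma_j^-)$, where $\Gamma_j^+$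 and $\Gamma_j^-$ are the induced labelled subgraphs of $\Gamma$ with vertex sets $$V(\Gamma_j^+)=\{x_{j+td}\mid 0\leq t<n/d\},\qquad V(\Gamma_j^-)=\{x_{j+q_0+td}^{-1}\mid 0\leq t<n/d\}$$ (subscripts mod $n$). In particular $|V(\Gamma_j^+)|=|V(\Gamma_j^-)|=n/d$ for all $0\leq j<d$, and the subscripts of the positive (respectively negative) vertices in any component are congruent mod $d$. (b) If $w$ is alternating then $\Gamma$ has $d_{\mathcal{A}}+d_{\mathcal{B}}$ connected components $\Gamma_0^+,\ldots,\Gamma_{d_{\mathcal{A}}-1}^+$ and $\Gamma_0^-,\ldots,\Gamma_{d_{\mathcal{B}}-1}^-$, which are, respectively, the induced labelled subgraphs of $\Gamma$ with vertex sets $$V(\Gamma_j^+)=\{x_{j+td_{\mathcal{A}}}\mid 0\leq t<n/d_{\mathcal{A}}\},\qquad V(\Gamma_j^-)=\{x_{j+td_{\mathcal{B}}}^{-1}\mid 0\leq t<n/d_{\mathcal{B}}\}$$ (subscripts mod $n$). Moreover each graph $\Gamma_j^+$ is isomorphic to the circulant graph $\mathrm{circ}_{n/d_{\mathcal{A}}}(\{a/d_{\mathcal{A}}\ (a\in\mathcal{A})\})$ and each graph $\Gamma_j^-$ is isomorphic to the circulant graph $\mathrm{circ}_{n/d_{\mathcal{B}}}(\{b/d_{\mathcal{B}}\ (b\in\mathcal{B})\})$.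
   Context: Cyclic presentations: $F_n$ is the free group with basis $x_0,\ldots,x_{n-1}$ and $\theta:F_n\to F_n$ is the automorphism $\theta(x_i)=x_{i+1}$ (subscripts mod $n$). For a cyclically reduced word $w\in F_n$, $P_n(w)=\langle x_0,\ldots,x_{n-1}\mid w,\theta(w),\ldots,\theta^{n-1}(w)\rangle$. Throughout it is assumed that $x_0$ is a letter of $w$. $l(w)$ is the length of $w$. A word is alternating if it has no cyclic subword of the form $(x_ix_j)^{\pm1}$. Length-two cyclic subwords consist of a letter and the cyclically next letter (a word of length one is followed by itself). The word $w$ is a proper power if $w=v^t$ for some $v$ and some $t\geq 2$. Non-redundant: a relator $r\in R$ of $\langle X\mid R\rangle$ is freely redundant if it is freely trivial or there is $s\in R$ such that $r,s$ are distinct elements of the free group on $X$ and $r$ is freely conjugate to $s$ or to $s^{-1}$. A presentation is non-redundant if it contains no freely redundant relator. Star graph: let $\tilde R$ be the set of all cyclic permutations of elements of $R\cup R^{-1}$. The star graph of $\langle X\mid R\rangle$ (all relators cyclically reduced) is the undirected vertex-labelled graph, possibly with multiple edges, with vertex set $X\cup X^{-1}$ and an edge joining $x$ and $y$ for each distinct word of the form $xy^{-1}u$ in $\tilde R$, where the edges corresponding to the inverse pair $xy^{-1}u$, $yx^{-1}u^{-1}$ are identified (a relator of length one, $x$, contributes the edge $x-x^{-1}$). Vertices in $X$ are called positive, those in $X^{-1}$ negative. Circulant graph: for $n\geq 2$ and a (multi)set $A$ of elements of $\{0,1,\ldots,n-1\}$, $\mathrm{circ}_n(A)$ is the (multi)graph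 with vertices $v_0,\ldots,v_{n-1}$ and edges $v_i-v_{i+a}$ for all $0\leq i<n$, $a\in A$ (subscripts mod $n$). *)

theory Defs
  imports
    "HOL-Algebra.Group"
    "HOL-Library.Multiset"
    "HOL-Library.Uprod"
    "HOL-Number_Theory.Cong"
begin

section \<open>Words and free groups\<close>

datatype 'a letter = Pos 'a | Neg 'a

fun linv :: "'a letter \<Rightarrow> 'a letter" where
  "linv (Pos x) = Neg x"
| "linv (Neg x) = Pos x"

definition winv :: "'a letter list \<Rightarrow> 'a letter list" where
  "winv w = rev (map linv w)"

definition reduced :: "'a letter list \<Rightarrow> bool" where
  "reduced w \<longleftrightarrow> successively (\<lambda>a b. b \<noteq> linv a) w"

definition cyclically_reduced :: "'a letter list \<Rightarrow> bool" where
  "cyclically_reduced w \<longleftrightarrow> reduced w \<and> (w \<noteq> [] \<longrightarrow> hd w \<noteq> linv (last w))"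

fun push :: "'a letter \<Rightarrow> 'a letter list \<Rightarrow> 'a letter list" where
  "push a [] = [a]"
| "push a (b # v) = (if b = linv a then v else a # b # v)"

definition free_reduce :: "'a letter list \<Rightarrow> 'a letter list" where
  "free_reduce w = foldr push w []"

text \<open>The free group on \<open>X\<close>: every element is represented by its unique reduced word, so
  equality of elements is equality of lists.\<close>

definition free_group :: "'a set \<Rightarrow> 'a letter list monoid" where
  "free_group X = \<lparr> carrier = {w. reduced w \<and> set w \<subseteq> Pos ` X \<union> Neg ` X},
                    monoid.mult = (\<lambda>u v. free_reduce (u @ v)), one = [] \<rparr>"

lemma linv_linv [simp]: "linv (linv a) = a"
  by (cases a) auto

lemma linv_inject [simp]: "linv a = linv b \<longleftrightarrow> a = b"
  by (metis linv_linv)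

lemma linv_neq [simp]: "linv a \<noteq> a" "a \<noteq> linv a"
  by (cases a; simp)+

lemma winv_winv [simp]: "winv (winv w) = w"
  by (simp add: winv_def rev_map comp_def)

lemma reduced_Nil [simp]: "reduced []"
  by (simp add: reduced_def)

lemma reduced_Cons: "reduced (a # v) \<longleftrightarrow> reduced v \<and> (v \<noteq> [] \<longrightarrow> hd v \<noteq> linv a)"
  by (cases v) (auto simp: reduced_def)

lemma reduced_push: "reduced v \<Longrightarrow> reduced (push a v)"
  by (cases v) (auto simp: reduced_Cons)

lemma reduced_foldr: "reduced v \<Longrightarrow> reduced (foldr push u v)"
  by (induction u) (auto simp: reduced_push)

lemma push_linv: "reduced v \<Longrightarrow> push a (push (linv a) v) = v"
proof (cases v)
  case (Cons b u)
  then show "reduced v \<Longrightarrow> ?thesis" by (cases u) (auto simp: reduced_Cons)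
qed simp

lemma foldr_push_push:
  assumes "reduced v" and "reduced u"
  shows "foldr push (push a u) v = push a (foldr push u v)"
proof (cases u)
  case (Cons b u')
  show ?thesis
  proof (cases "b = linv a")
    case True
    then show ?thesis using Cons assms push_linv[of "foldr push u' v" a]
      by (simp add: reduced_foldr)
  qed (use Cons in simp)
qed simp

lemma foldr_push_free_reduce:
  assumes "reduced v"
  shows "foldr push (free_reduce u) v = foldr push u v"
  using assms
  by (induction u) (simp_all add: free_reduce_def foldr_push_push reduced_foldr)

lemma free_reduce_reduced: "reduced w \<Longrightarrow> free_reduce w = w"
proof (induction w)
  case (Cons a w)
  then show ?case by (cases w) (auto simp: free_reduce_def reduced_Cons)
qed (simp add: free_reduce_def)

lemma free_reduce_append: "free_reduce (u @ v) = foldr push u (free_reduce v)"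
  by (simp add: free_reduce_def)

lemma free_reduce_append_left: "free_reduce (free_reduce u @ v) = free_reduce (u @ v)"
  by (simp add: free_reduce_append foldr_push_free_reduce reduced_foldr
      free_reduce_def[of v])

lemma reduced_free_reduce [simp]: "reduced (free_reduce w)"
  by (simp add: free_reduce_def reduced_foldr)

lemma free_reduce_append_right: "free_reduce (u @ free_reduce v) = free_reduce (u @ v)"
  by (simp add: free_reduce_append free_reduce_reduced)

lemma set_push: "set (push a v) \<subseteq> insert a (set v)"
  by (cases v) auto

lemma set_free_reduce: "set (free_reduce w) \<subseteq> set w"
proof (induction w)
  case (Cons a w)
  then show ?case using set_push[of a "free_reduce w"] by (auto simp: free_reduce_def)
qed (simp add: free_reduce_def)

lemma reduced_winv: "reduced w \<Longrightarrow> reduced (winv w)"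
proof -
  assume "reduced w"
  then have "successively (\<lambda>a b. a \<noteq> linv b) w"
    unfolding reduced_def by (rule successively_mono) auto
  then show ?thesis
    by (simp add: reduced_def winv_def successively_map)
qed

lemma set_winv: "set (winv w) = linv ` set w"
  by (simp add: winv_def)

lemma free_reduce_winv: "free_reduce (winv w @ w) = []"
proof (induction w)
  case (Cons a w)
  have "free_reduce (winv (a # w) @ a # w)
      = foldr push (winv w) (push (linv a) (push (linv (linv a)) (free_reduce w)))"
    by (simp add: winv_def free_reduce_def)
  also have "\<dots> = free_reduce (winv w @ w)"
    by (subst push_linv) (simp_all add: free_reduce_append)
  finally show ?case using Cons by simp
qed (simp add: winv_def free_reduce_def)

lemma winv_in_free_group:
  "w \<in> carrier (free_group X) \<Longrightarrow> winv w \<in> carrier (free_group X)"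
  by (fastforce simp: free_group_def reduced_winv set_winv)

lemma group_free_group: "group (free_group X)"
proof (rule groupI)
  fix x y z
  assume "x \<in> carrier (free_group X)" "y \<in> carrier (free_group X)"
  then show "x \<otimes>\<^bsub>free_group X\<^esub> y \<in> carrier (free_group X)"
    using set_free_reduce[of "x @ y"] by (auto simp: free_group_def)
next
  fix x assume x: "x \<in> carrier (free_group X)"
  have "winv x \<otimes>\<^bsub>free_group X\<^esub> x = \<one>\<^bsub>free_group X\<^esub>"
    by (simp add: free_group_def free_reduce_winv)
  then show "\<exists>y\<in>carrier (free_group X). y \<otimes>\<^bsub>free_group X\<^esub> x = \<one>\<^bsub>free_group X\<^esub>"
    using winv_in_free_group[OF x] by blast
qed (auto simp: free_group_def free_reduce_append_left free_reduce_append_right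
      free_reduce_reduced)

lemma inv_free_group:
  assumes "w \<in> carrier (free_group X)"
  shows "inv\<^bsub>free_group X\<^esub> w = winv w"
proof -
  interpret group "free_group X" by (rule group_free_group)
  show ?thesis
    by (rule inv_equality)
      (use assms winv_in_free_group in \<open>auto simp: free_group_def free_reduce_winv\<close>)
qed

definition proper_power :: "'a set \<Rightarrow> 'a letter list \<Rightarrow> bool" where
  "proper_power X w \<longleftrightarrow>
     (\<exists>v\<in>carrier (free_group X). \<exists>t::nat. t \<ge> 2 \<and> w = v [^]\<^bsub>free_group X\<^esub> t)"

definition freely_conjugate :: "'a set \<Rightarrow> 'a letter list \<Rightarrow> 'a letter list \<Rightarrow> bool" where
  "freely_conjugate X r s \<longleftrightarrow>
     (\<exists>g\<in>carrier (free_group X).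
        r = g \<otimes>\<^bsub>free_group X\<^esub> s \<otimes>\<^bsub>free_group X\<^esub> inv\<^bsub>free_group X\<^esub> g)"


section \<open>Presentations\<close>

text \<open>A presentation is given by its generators \<open>X\<close> and its set \<open>R\<close> of relators, which are
  elements of \<open>free_group X\<close>.\<close>

definition freely_redundant :: "'a set \<Rightarrow> 'a letter list set \<Rightarrow> 'a letter list \<Rightarrow> bool" where
  "freely_redundant X R r \<longleftrightarrow>
     r = \<one>\<^bsub>free_group X\<^esub> \<or>
     (\<exists>s\<in>R. r \<noteq> s \<and>
        (freely_conjugate X r s \<or> freely_conjugate X r (inv\<^bsub>free_group X\<^esub> s)))"

definition non_redundant :: "'a set \<Rightarrow> 'a letter list set \<Rightarrow> bool" where
  "non_redundant X R \<longleftrightarrow> (\<forall>r\<in>R. \<not> freely_redundant X R r)"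

text \<open>The generators \<open>x\<^sub>0, \<dots>, x\<^sub>n\<^sub>-\<^sub>1\<close> are represented by \<open>{..<n}\<close>. Renaming generators keeps words
  reduced, so the automorphism \<open>\<theta>\<close> acts letter by letter.\<close>

definition shift :: "nat \<Rightarrow> nat letter list \<Rightarrow> nat letter list" where
  "shift n w = map (map_letter (\<lambda>i. (i + 1) mod n)) w"

definition cyclic_relators :: "nat \<Rightarrow> nat letter list \<Rightarrow> nat letter list set" where
  "cyclic_relators n w = {(shift n ^^ i) w | i. i < n}"

text \<open>All pairs of a letter and the cyclically next letter, one for each position; a one-letter
  word \<open>[x]\<close> yields \<open>(x, x)\<close>.\<close>

definition cyclic_pairs :: "'a letter list \<Rightarrow> ('a letter \<times> 'a letter) list" where
  "cyclic_pairs w = zip w (rotate1 w)"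

definition alternating :: "'a letter list \<Rightarrow> bool" where
  "alternating w \<longleftrightarrow>
     \<not> (\<exists>i j. (Pos i, Pos j) \<in> set (cyclic_pairs w) \<or> (Neg j, Neg i) \<in> set (cyclic_pairs w))"

text \<open>The \<open>a \<in> {0..<n}\<close> with \<open>j = i + a\<close> modulo \<open>n\<close>.\<close>

definition offset :: "nat \<Rightarrow> nat \<Rightarrow> nat \<Rightarrow> nat" where
  "offset n i j = nat ((int j - int i) mod int n)"

definition offsets_A :: "nat \<Rightarrow> nat letter list \<Rightarrow> nat multiset" where
  "offsets_A n w = mset [offset n i j. (Pos i, Neg j) \<leftarrow> cyclic_pairs w]"

definition offsets_B :: "nat \<Rightarrow> nat letter list \<Rightarrow> nat multiset" where
  "offsets_B n w = mset [offset n i j. (Neg i, Pos j) \<leftarrow> cyclic_pairs w]"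

definition offsets_Q :: "nat \<Rightarrow> nat letter list \<Rightarrow> nat multiset" where
  "offsets_Q n w =
     mset [offset n i j. (Pos i, Pos j) \<leftarrow> cyclic_pairs w] +
     mset [offset n i j. (Neg j, Neg i) \<leftarrow> cyclic_pairs w]"

lemma alternating_iff_offsets_Q: "alternating w \<longleftrightarrow> offsets_Q n w = {#}"
  by (fastforce simp: alternating_def offsets_Q_def split: prod.splits letter.splits)


section \<open>Undirected multigraphs\<close>

text \<open>Edges are unordered pairs of vertices; the multiplicity of an edge is its number of
  occurrences in the multiset.\<close>

record 'v multigraph =
  verts :: "'v set"
  edges :: "'v uprod multiset"

definition degree :: "'v multigraph \<Rightarrow> 'v \<Rightarrow> nat" where
  "degree G v =
     (\<Sum>e\<in>#edges G. if e = Upair v v then 2 else if v \<in> set_uprod e then 1 else 0)"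

definition regular :: "'v multigraph \<Rightarrow> nat \<Rightarrow> bool" where
  "regular G k \<longleftrightarrow> (\<forall>v\<in>verts G. degree G v = k)"

definition induced :: "'v multigraph \<Rightarrow> 'v set \<Rightarrow> 'v multigraph" where
  "induced G U = \<lparr> verts = U, edges = {# e \<in># edges G. set_uprod e \<subseteq> U #} \<rparr>"

definition reachable :: "'v multigraph \<Rightarrow> 'v rel" where
  "reachable G = {(u, v). Upair u v \<in># edges G}\<^sup>*"

definition components :: "'v multigraph \<Rightarrow> 'v multigraph set" where
  "components G = {induced G {u \<in> verts G. (v, u) \<in> reachable G} | v. v \<in> verts G}"

definition graph_isomorphic :: "'v multigraph \<Rightarrow> 'u multigraph \<Rightarrow> bool" where
  "graph_isomorphic G H \<longleftrightarrow>
     (\<exists>f. bij_betw f (verts G) (verts H) \<and> image_mset (map_uprod f) (edges G) = edges H)"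

definition circulant :: "nat \<Rightarrow> nat multiset \<Rightarrow> nat multigraph" where
  "circulant n A =
     \<lparr> verts = {..<n}, edges = (\<Sum>i<n. {# Upair i ((i + a) mod n). a \<in># A #}) \<rparr>"


section \<open>The star graph\<close>

definition cyclic_closure :: "'a letter list set \<Rightarrow> 'a letter list set" where
  "cyclic_closure R = {rotate k v | k v. v \<in> R \<union> winv ` R}"

text \<open>The word \<open>x y\<inverse> u\<close> is paired with \<open>y x\<inverse> u\<inverse>\<close>; in the code \<open>y\<close> stands for the letter
  \<open>y\<inverse>\<close>.\<close>

fun edge_partner :: "'a letter list \<Rightarrow> 'a letter list" where
  "edge_partner [] = []"
| "edge_partner [x] = [linv x]"
| "edge_partner (x # y # u) = linv y # linv x # winv u"

text \<open>The end points \<open>x\<close>, \<open>y\<close> of the edge given by \<open>x y\<inverse> u\<close>. A one-letter word is its own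
  rotation, so \<open>[x]\<close> gives the end points \<open>x\<close>, \<open>x\<inverse>\<close>.\<close>

definition edge_ends :: "'a letter list \<Rightarrow> 'a letter uprod" where
  "edge_ends v = Upair (hd v) (linv (hd (rotate1 v)))"

lemma edge_ends_partner: "v \<noteq> [] \<Longrightarrow> edge_ends (edge_partner v) = edge_ends v"
  by (cases v rule: edge_partner.cases) (auto simp: edge_ends_def)

lemma edge_partner_invol: "edge_partner (edge_partner v) = v"
  by (cases v rule: edge_partner.cases) auto

text \<open>There is one edge for each pair \<open>{v, edge_partner v}\<close>. By \<open>edge_ends_partner\<close> both words of
  a pair have the same end points, so \<open>the_elem\<close> picks a well-defined value. The use of
  \<open>mset_set\<close> restricts the definition to finite sets of relators.\<close>

definition star_graph :: "'a set \<Rightarrow> 'a letter list set \<Rightarrow> 'a letter multigraph" where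
  "star_graph X R =
     \<lparr> verts = Pos ` X \<union> Neg ` X,
       edges = {# the_elem (edge_ends ` c).
                  c \<in># mset_set {{v, edge_partner v} | v. v \<in> cyclic_closure R \<and> v \<noteq> []} #} \<rparr>"

end

theory Submission
  imports Defs
begin

text \<open>A rotation of a relator determines both the relator and the amount of rotation: two distinct
  relators are not freely conjugate up to inversion, \<open>w\<close> is not a proper power, and no nonempty
  reduced word is a rotation of its inverse. Hence the edges of the star graph correspond
  exactly to the positions in the words \<open>\<theta>\<^sup>i(w)\<close>, and collecting them over \<open>i\<close> gives the edge
  formula. For the components, let \<open>\<kappa>\<close> send a positive vertex \<open>x\<^sub>i\<close> to \<open>i\<close> modulo \<open>d\<close> and a
  negative vertex with subscript \<open>i\<close> to \<open>i - q\<^sub>0\<close> modulo \<open>d\<close>. It is constant along edges, and its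
  fibres are connected because the \<open>m\<close> such that every \<open>x\<^sub>z\<close> is joined by a path to \<open>x\<^sub>z\<^sub>+\<^sub>m\<close> form
  a subgroup of the integers, which contains \<open>n\<close>, all \<open>a\<close>, \<open>b\<close> and \<open>q - q\<^sub>0\<close>, and so \<open>d\<close>.\<close>

section \<open>Rotations of reduced words\<close>

lemma linv_map_letter: "linv (map_letter f x) = map_letter f (linv x)"
  by (cases x) auto

lemma length_winv [simp]: "length (winv w) = length w"
  by (simp add: winv_def)

lemma winv_append: "winv (u @ v) = winv v @ winv u"
  by (simp add: winv_def)

text \<open>Equality with the inverse would make the letters at mirrored positions mutually inverse.
  In odd length the middle letter would then be its own inverse; in even length the two middle
  letters would cancel, against reducedness.\<close>

lemma winv_neq_self:
  assumes "reduced v" "v \<noteq> []"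
  shows "winv v \<noteq> v"
proof
  assume eq: "winv v = v"
  define l where "l = length v"
  have nth: "v ! i = linv (v ! (l - Suc i))" if "i < l" for i
  proof -
    have "v ! i = winv v ! i" by (simp add: eq)
    then show ?thesis using that by (simp add: winv_def rev_nth l_def)
  qed
  have "l > 0" using assms by (simp add: l_def)
  show False
  proof (cases "even l")
    case True
    then obtain m where m: "l = 2 * m" by auto
    with \<open>l > 0\<close> obtain p where p: "m = Suc p" by (cases m) auto
    have "v ! p = linv (v ! Suc p)" using nth[of p] m p by simp
    moreover have "v ! Suc p \<noteq> linv (v ! p)"
      using assms m p by (auto simp: reduced_def successively_conv_nth l_def)
    ultimately show False by simp
  next
    case False
    then obtain m where "l = 2 * m + 1" by (elim oddE)
    then show False using nth[of m] by simp
  qed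
qed

lemma rotate_split:
  "s = rotate m r \<Longrightarrow> \<exists>u v. r = u @ v \<and> s = v @ u"
  by (metis append_take_drop_id rotate_drop_take)

lemma rotate_eq_rotate:
  assumes "rotate k r = rotate k' s"
  shows "\<exists>m. s = rotate m r"
proof -
  have len: "length r = length s"
    using assms by (metis length_rotate)
  \<comment> \<open>Rotation by \<open>k'\<close> is undone by completing it to a full turn;
    reducing \<open>k'\<close> modulo the length keeps the subtraction from truncating.\<close>
  have "rotate (length s - k' mod length s) (rotate k' s) = s"
  proof (cases "s = []")
    case False
    have "rotate (length s - k' mod length s) (rotate k' s)
        = rotate (length s - k' mod length s) (rotate (k' mod length s) s)"
      by (metis rotate_conv_mod)
    also have "\<dots> = rotate (length s) s"
      using False by (simp add: rotate_rotate)
    finally show ?thesis by simp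
  qed simp
  then show ?thesis using assms by (metis rotate_rotate)
qed

lemma winv_rotate: "\<exists>m. winv (rotate k v) = rotate m (winv v)"
proof -
  obtain a b where "v = a @ b" "rotate k v = b @ a"
    using rotate_split[of "rotate k v" k v] by blast
  then have "winv (rotate k v) = rotate (length (winv b)) (winv v)"
    by (simp only: winv_append rotate_append)
  then show ?thesis by blast
qed

text \<open>Cutting \<open>w\<close> into \<open>u @ v\<close> at the rotation point, comparison of
  the two words piece by piece makes both \<open>u\<close> and \<open>v\<close> equal to their
  inverses. One of them is nonempty, which \<open>winv_neq_self\<close> excludes.\<close>

lemma rotate_neq_winv:
  assumes "reduced w" "w \<noteq> []"
  shows "rotate m w \<noteq> winv w"
proof
  assume eq: "rotate m w = winv w"
  obtain u v where uv: "w = u @ v" "rotate m w = v @ u"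
    using rotate_split[of "rotate m w" m w] by blast
  then have "v @ u = winv v @ winv u" using eq by (simp add: winv_append)
  then have "winv v = v" "winv u = u" by simp_all
  moreover have "reduced u" "reduced v"
    using assms uv by (auto simp: reduced_def successively_append_iff)
  ultimately show False using winv_neq_self uv assms by auto
qed

section \<open>Periodic words and freely conjugate relators\<close>

lemma replicate_Suc_append: "replicate (Suc t) v = replicate t v @ [v]"
  by (simp add: replicate_append_same)

lemma pow_free_group:
  "v [^]\<^bsub>free_group X\<^esub> (t::nat) = free_reduce (concat (replicate t v))"
proof (induction t)
  case 0
  then show ?case by (simp add: free_group_def free_reduce_def)
next
  case (Suc t)
  have "concat (replicate (Suc t) v) = concat (replicate t v) @ v"
    by (simp add: replicate_Suc_append del: replicate_Suc)
  then show ?case using Suc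
    by (simp add: nat_pow_Suc free_group_def free_reduce_append_left)
qed

text \<open>A nontrivial rotation fixing \<open>w\<close> splits it into two nonempty words that
  commute under concatenation. Commuting words are powers of a common word \<open>z\<close>, so
  \<open>w\<close> is a power of \<open>z\<close> with exponent at least two.\<close>

lemma rotate_primitive:
  assumes w: "w \<in> carrier (free_group X)" "\<not> proper_power X w"
    and k: "k < length w" "rotate k w = w"
  shows "k = 0"
proof (rule ccontr)
  assume "k \<noteq> 0"
  define u v where "u = take k w" and "v = drop k w"
  have uv: "w = u @ v" "u \<noteq> []" "v \<noteq> []"
    using k \<open>k \<noteq> 0\<close> by (auto simp: u_def v_def)
  have "u @ v = v @ u"
    using k by (simp add: rotate_drop_take u_def v_def)
  then obtain m p z where z: "concat (replicate m z) = u" "concat (replicate p z) = v"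
    using comm_append_are_replicate by blast
  have w_eq: "w = concat (replicate (m + p) z)"
    by (simp add: replicate_add z uv)
  have "reduced w" using w by (simp add: free_group_def)
  have "m > 0" "p > 0" using z uv by (auto intro: gr0I)
  then obtain m' where "m = Suc m'" by (cases m) auto
  then have "w = z @ concat (replicate (m' + p) z)" using w_eq by simp
  \<comment> \<open>As a prefix of the reduced word \<open>w\<close>, \<open>z\<close> is reduced;
    and as \<open>w\<close> is reduced, concatenating the copies of \<open>z\<close> agrees with
    taking the power in the free group.\<close>
  then have "z \<in> carrier (free_group X)"
    using w by (auto simp: free_group_def reduced_def successively_append_iff)
  moreover have "w = z [^]\<^bsub>free_group X\<^esub> (m + p)"
    using \<open>reduced w\<close> w_eq by (metis pow_free_group free_reduce_reduced)
  ultimately have "proper_power X w"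
    using \<open>m > 0\<close> \<open>p > 0\<close> unfolding proper_power_def
    by (intro bexI[of _ z] exI[of _ "m + p"]) auto
  then show False using w by simp
qed

text \<open>Conjugating \<open>v @ u\<close> by \<open>u\<close> gives \<open>u @ v\<close>, because
  the trailing \<open>u\<close> cancels against its inverse.\<close>

lemma freely_conjugate_rotation:
  assumes "u @ v \<in> carrier (free_group X)"
  shows "freely_conjugate X (u @ v) (v @ u)"
proof -
  have u: "u \<in> carrier (free_group X)"
    using assms by (auto simp: free_group_def reduced_def successively_append_iff)
  have "free_reduce (free_reduce (u @ v @ u) @ winv u) = free_reduce ((u @ v) @ free_reduce (u @ winv u))"
    using free_reduce_append_right[of "u @ v" "u @ winv u"]
    by (simp add: free_reduce_append_left)
  also have "free_reduce (u @ winv u) = []"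
    using free_reduce_winv[of "winv u"] by simp
  also have "free_reduce ((u @ v) @ []) = u @ v"
    using assms by (simp add: free_group_def free_reduce_reduced)
  finally show ?thesis
    using u inv_free_group[OF u] by (auto simp: freely_conjugate_def free_group_def)
qed

text \<open>A common rotation makes \<open>r\<close> a rotation of \<open>s\<close> or of its
  inverse, hence freely conjugate to it. If \<open>r\<close> and \<open>s\<close> differed,
  \<open>r\<close> would be freely redundant.\<close>

lemma non_redundant_rotate_eq:
  assumes "non_redundant X R" "R \<subseteq> carrier (free_group X)" "r \<in> R" "s \<in> R"
    and "rotate k r = rotate k' s \<or> rotate k r = rotate k' (winv s)"
  shows "r = s"
proof (rule ccontr)
  assume "r \<noteq> s"
  obtain s' where s': "s' = s \<or> s' = winv s" "rotate k r = rotate k' s'"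
    using assms(5) by blast
  obtain u v where "r = u @ v" "s' = v @ u"
    using rotate_eq_rotate[OF s'(2)] rotate_split by metis
  then have "freely_conjugate X r s'"
    using freely_conjugate_rotation assms by blast
  moreover have "inv\<^bsub>free_group X\<^esub> s = winv s"
    using inv_free_group assms by blast
  ultimately have "freely_redundant X R r"
    using s' \<open>r \<noteq> s\<close> \<open>s \<in> R\<close> unfolding freely_redundant_def by metis
  then show False using assms by (auto simp: non_redundant_def)
qed

section \<open>Edge words as rotations\<close>

lemma edge_partner_eq_rotate: "edge_partner v = rotate (length v - 2) (winv v)"
proof (cases v rule: edge_partner.cases)
  case (3 x y u)
  have "rotate (length (winv u)) (winv u @ [linv y, linv x]) = [linv y, linv x] @ winv u"
    by (rule rotate_append)
  then show ?thesis using 3 by (simp add: winv_def)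
qed (auto simp: winv_def)

text \<open>The rotation by \<open>k\<close> starts with the letter at position \<open>k\<close> and
  its cyclic successor. This turns edges of the star graph into positions in a relator.\<close>

lemma edge_ends_rotate:
  assumes "k < length w"
  shows "edge_ends (rotate k w) = (case cyclic_pairs w ! k of (x, y) \<Rightarrow> Upair x (linv y))"
proof -
  have w: "w \<noteq> []" using assms by auto
  have "hd (rotate k w) = w ! k"
    using assms w by (simp add: hd_rotate_conv_nth)
  moreover have "rotate1 (rotate k w) = rotate k (rotate1 w)"
    by (metis rotate1_rotate_swap)
  moreover have "hd (rotate k (rotate1 w)) = rotate1 w ! k"
    using assms w by (simp add: hd_rotate_conv_nth)
  ultimately show ?thesis
    using assms by (simp add: edge_ends_def cyclic_pairs_def)
qed

section \<open>Edges of the star graph\<close>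

lemma image_mset_set_eq_sum:
  "finite I \<Longrightarrow> image_mset f (mset_set I) = (\<Sum>i\<in>I. {#f i#})"
  by (induction I rule: finite_induct) auto

lemma image_mset_mset_eq_sum_nth:
  "image_mset f (mset xs) = (\<Sum>k<length xs. {#f (xs ! k)#})"
proof -
  have "map f xs = map (\<lambda>k. f (xs ! k)) [0..<length xs]"
    by (auto intro: nth_equalityI)
  then have "mset (map f xs) = mset (map (\<lambda>k. f (xs ! k)) [0..<length xs])"
    by (rule arg_cong)
  then show ?thesis
    by (simp only: mset_map mset_upt image_mset_set_eq_sum finite_lessThan atLeast0LessThan)
qed

text \<open>By \<open>disj\<close>, each class of a word and its partner contains exactly one
  rotation of a relator, the other member being a rotation of an inverse. By \<open>inj\<close>,
  that rotation determines the relator index and the position, so the pairs in \<open>P\<close>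
  enumerate the edges without repetition.\<close>

lemma edges_star_graph:
  fixes r :: "nat \<Rightarrow> 'a letter list" and n l :: nat
  defines "P \<equiv> {..<n} \<times> {..<l}"
    and "W \<equiv> \<lambda>p. rotate (snd p) (r (fst p))"
  assumes len: "\<And>i. i < n \<Longrightarrow> length (r i) = l" and l: "l > 0"
    and inj: "inj_on W P"
    and disj: "\<And>i j k k'. i < n \<Longrightarrow> j < n \<Longrightarrow> rotate k (r i) \<noteq> rotate k' (winv (r j))"
  shows "edges (star_graph X (r ` {..<n})) =
    (\<Sum>i<n. image_mset (\<lambda>(x, y). Upair x (linv y)) (mset (cyclic_pairs (r i))))"
proof -
  define c where "c = (\<lambda>v :: 'a letter list. {v, edge_partner v})"
  have W: "rotate k (r i) \<in> W ` P" if "i < n" for i k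
  proof -
    have "rotate k (r i) = W (i, k mod l)"
      using len that by (metis W_def fst_conv snd_conv rotate_conv_mod)
    moreover have "(i, k mod l) \<in> P" using that l by (simp add: P_def)
    ultimately show ?thesis by blast
  qed
  have WE: "\<exists>i k. i < n \<and> v = rotate k (r i)" if "v \<in> W ` P" for v
    using that unfolding W_def P_def by fastforce
  have partner_rot: "\<exists>k'. edge_partner (rotate k v) = rotate k' (winv v)" for k and v :: "'a letter list"
    by (metis edge_partner_eq_rotate winv_rotate rotate_rotate)
  \<comment> \<open>The involution \<open>edge_partner\<close> exchanges rotations of a relator with
    rotations of its inverse.\<close>
  have closure: "cyclic_closure (r ` {..<n}) = W ` P \<union> edge_partner ` W ` P"
  proof (intro equalityI subsetI)
    fix v assume "v \<in> cyclic_closure (r ` {..<n})"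
    then obtain i k where i: "i < n" and "v = rotate k (r i) \<or> v = rotate k (winv (r i))"
      by (auto simp: cyclic_closure_def)
    then show "v \<in> W ` P \<union> edge_partner ` W ` P"
    proof (elim disjE)
      assume v: "v = rotate k (winv (r i))"
      obtain k' where "edge_partner v = rotate k' (r i)"
        using partner_rot[of k "winv (r i)"] v by auto
      then show ?thesis using W[OF i] edge_partner_invol[of v] by (metis UnI2 imageI)
    qed (use W in auto)
  next
    fix v assume "v \<in> W ` P \<union> edge_partner ` W ` P"
    then consider "v \<in> W ` P" | u where "u \<in> W ` P" "v = edge_partner u"
      by (elim UnE imageE[of v edge_partner]) simp_all
    then have "\<exists>i k. i < n \<and> (v = rotate k (r i) \<or> v = rotate k (winv (r i)))"
    proof cases
      case 1
      then show ?thesis using WE[of v] by blast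
    next
      case (2 u)
      obtain i k where i: "i < n" "u = rotate k (r i)" using WE[OF 2(1)] by blast
      obtain k' where "edge_partner (rotate k (r i)) = rotate k' (winv (r i))"
        using partner_rot by blast
      then show ?thesis using i 2 by (intro exI[of _ i] exI[of _ k']) simp
    qed
    then show "v \<in> cyclic_closure (r ` {..<n})"
      by (fastforce simp: cyclic_closure_def)
  qed
  have neq: "edge_partner u \<noteq> v" if u: "u \<in> W ` P" and v: "v \<in> W ` P" for u v
  proof -
    obtain i k where i: "i < n" "u = rotate k (r i)" using WE[OF u] by blast
    obtain j m where j: "j < n" "v = rotate m (r j)" using WE[OF v] by blast
    obtain k' where "edge_partner u = rotate k' (winv (r i))"
      using partner_rot[of k "r i"] i by blast
    then show ?thesis using disj[OF j(1) i(1), of m k'] j by simp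
  qed
  have nonempty: "v \<noteq> []" if "v \<in> W ` P" for v
    using WE[OF that] len l by force
  have c_partner: "c (edge_partner v) = c v" for v
    by (auto simp: c_def edge_partner_invol)
  have partner_nonempty: "edge_partner v \<noteq> []" if "v \<noteq> []" for v :: "'a letter list"
    using that by (cases v rule: edge_partner.cases) auto
  have "{{v, edge_partner v} | v. v \<in> cyclic_closure (r ` {..<n}) \<and> v \<noteq> []}
      = c ` (W ` P \<union> edge_partner ` W ` P)"
    unfolding closure c_def using nonempty partner_nonempty by blast
  also have "\<dots> = (c \<circ> W) ` P"
    by (auto simp: c_partner image_Un image_image)
  finally have classes: "{{v, edge_partner v} | v. v \<in> cyclic_closure (r ` {..<n}) \<and> v \<noteq> []}
      = (c \<circ> W) ` P" .
  \<comment> \<open>Two classes can coincide only if their chosen words are equal or partners of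
    each other; the latter is ruled out by \<open>neq\<close>.\<close>
  have "inj_on c (W ` P)"
    using neq by (intro inj_onI) (metis c_def doubleton_eq_iff)
  then have inj': "inj_on (c \<circ> W) P"
    using inj by (rule comp_inj_on[rotated])
  \<comment> \<open>Both members of a class have the same end points, so the image is a
    singleton.\<close>
  have ends: "the_elem (edge_ends ` c (W p)) = edge_ends (W p)" if "p \<in> P" for p
    using nonempty that by (auto simp: c_def edge_ends_partner)
  have fin: "finite P" by (simp add: P_def)
  have "edges (star_graph X (r ` {..<n}))
      = image_mset (\<lambda>e. the_elem (edge_ends ` e)) (mset_set ((c \<circ> W) ` P))"
    unfolding star_graph_def classes by simp
  also have "\<dots> = image_mset (\<lambda>e. the_elem (edge_ends ` e)) (image_mset (c \<circ> W) (mset_set P))"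
    by (simp only: image_mset_mset_set[OF inj'])
  also have "\<dots> = image_mset (\<lambda>p. the_elem (edge_ends ` c (W p))) (mset_set P)"
    by (simp add: multiset.map_comp comp_def)
  also have "\<dots> = (\<Sum>p\<in>P. {#edge_ends (W p)#})"
    using ends fin by (simp add: image_mset_set_eq_sum)
  also have "\<dots> = (\<Sum>i<n. \<Sum>k<l. {#edge_ends (rotate k (r i))#})"
    unfolding P_def W_def by (simp add: sum.cartesian_product case_prod_beta)
  also have "\<dots> = (\<Sum>i<n. image_mset (\<lambda>(x, y). Upair x (linv y)) (mset (cyclic_pairs (r i))))"
  proof (rule sum.cong)
    fix i assume "i \<in> {..<n}"
    moreover have "length (cyclic_pairs (r i)) = length (r i)"
      by (simp add: cyclic_pairs_def)
    ultimately show "(\<Sum>k<l. {#edge_ends (rotate k (r i))#})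
        = image_mset (\<lambda>(x, y). Upair x (linv y)) (mset (cyclic_pairs (r i)))"
      using len by (simp add: image_mset_mset_eq_sum_nth edge_ends_rotate)
  qed simp
  finally show ?thesis .
qed

section \<open>Shifting subscripts modulo \<open>n\<close>\<close>

lemma mod_add_left_inj:
  assumes "x < n" "y < n" "(x + c) mod n = (y + c) mod (n::nat)"
  shows "x = y"
  using assms by (metis cong_add_rcancel_nat cong_def mod_less)

lemma sum_shift_mod:
  fixes n c :: nat and g :: "nat \<Rightarrow> 'b::comm_monoid_add"
  shows "(\<Sum>i<n. g ((c + i) mod n)) = (\<Sum>i<n. g i)"
proof (cases "n = 0")
  case False
  have inj: "inj_on (\<lambda>i. (c + i) mod n) {..<n}"
    by (intro inj_onI) (metis mod_add_left_inj add.commute lessThan_iff)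
  moreover have "(\<lambda>i. (c + i) mod n) ` {..<n} = {..<n}"
    using False inj by (intro endo_inj_surj) auto
  ultimately have "bij_betw (\<lambda>i. (c + i) mod n) {..<n} {..<n}"
    by (simp add: bij_betw_def)
  then show ?thesis by (rule sum.reindex_bij_betw)
qed simp

lemma add_offset_mod:
  assumes "i < n"
  shows "(i + offset n i j) mod n = j mod n"
proof -
  have "int ((i + offset n i j) mod n) = (int i + (int j - int i) mod int n) mod int n"
    using assms by (simp add: offset_def zmod_int)
  also have "\<dots> = int (j mod n)" by (simp add: mod_simps zmod_int)
  finally show ?thesis by simp
qed

lemma map_letter_inj_on:
  assumes "inj_on f S"
  shows "inj_on (map_letter f) (Pos ` S \<union> Neg ` S)"
proof (rule inj_onI)
  fix x y
  assume "x \<in> Pos ` S \<union> Neg ` S" "y \<in> Pos ` S \<union> Neg ` S" "map_letter f x = map_letter f y"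
  then show "x = y"
    by (cases x; cases y) (auto dest: inj_onD[OF assms])
qed

lemma map_map_letter_inj:
  assumes "inj_on f S" "set u \<subseteq> Pos ` S \<union> Neg ` S" "set v \<subseteq> Pos ` S \<union> Neg ` S"
    and "map (map_letter f) u = map (map_letter f) v"
  shows "u = v"
  using assms map_letter_inj_on[OF assms(1)]
  by (metis Un_subset_iff inj_on_map_eq_map inj_on_subset)

text \<open>A renaming that is injective on the subscripts in use cannot create a cancelling pair:
  the set of signed letters is closed under \<open>linv\<close>, so injectivity can be applied to
  \<open>y\<close> and \<open>linv x\<close>.\<close>

lemma reduced_map_letter:
  assumes "reduced w" "inj_on f S" "set w \<subseteq> Pos ` S \<union> Neg ` S"
  shows "reduced (map (map_letter f) w)"
  unfolding reduced_def successively_conv_nth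
proof (intro allI impI)
  fix i assume i: "Suc i < length (map (map_letter f) w)"
  define x y where "x = w ! i" and "y = w ! Suc i"
  have mem: "x \<in> Pos ` S \<union> Neg ` S" "y \<in> Pos ` S \<union> Neg ` S"
    using i nth_mem[of i w] nth_mem[of "Suc i" w] subsetD[OF assms(3)]
    unfolding x_def y_def by simp_all
  moreover have "linv x \<in> Pos ` S \<union> Neg ` S"
    using mem by auto
  moreover have "y \<noteq> linv x"
    using i assms(1) by (simp add: reduced_def successively_conv_nth x_def y_def)
  ultimately have "map_letter f y \<noteq> map_letter f (linv x)"
    using map_letter_inj_on[OF assms(2)] by (metis inj_onD)
  then show "map (map_letter f) w ! Suc i \<noteq> linv (map (map_letter f) w ! i)"
    using i by (simp add: linv_map_letter x_def y_def)
qed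

lemma funpow_shift:
  assumes "set w \<subseteq> Pos ` {..<n} \<union> Neg ` {..<n}"
  shows "(shift n ^^ c) w = map (map_letter (\<lambda>x. (x + c) mod n)) w"
proof (induction c)
  case 0
  \<comment> \<open>With \<open>c = 0\<close> the renaming still reduces modulo \<open>n\<close>,
    which is the identity only on subscripts below \<open>n\<close>.\<close>
  have "map_letter (\<lambda>x. x mod n) x = x" if "x \<in> set w" for x
    using that assms by auto
  then show ?case by (simp add: map_idI)
next
  case (Suc c)
  then show ?case by (simp add: shift_def letter.map_comp comp_def mod_Suc_eq)
qed

lemma cyclic_pairs_map: "cyclic_pairs (map f w) = map (map_prod f f) (cyclic_pairs w)"
  by (simp add: cyclic_pairs_def rotate1_map zip_map_map map_prod_def)

text \<open>The two subscripts keep a constant difference under the shift, so reindexing the sum by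
  the subscript of the first end leaves only the offset.\<close>

lemma sum_edges_shifted_pair:
  assumes "u < n" "v < n"
  shows "(\<Sum>i<n. {#Upair (c ((u + i) mod n)) (c' ((v + i) mod n))#})
    = (\<Sum>i<n. {#Upair (c i) (c' ((i + offset n u v) mod n))#})"
proof -
  have "(v + i) mod n = ((u + i) mod n + offset n u v) mod n" for i
    using add_offset_mod[of u n v] assms
    by (metis (no_types, opaque_lifting) add.assoc add.commute mod_add_left_eq)
  then show ?thesis
    using sum_shift_mod[of "\<lambda>i. {#Upair (c i) (c' ((i + offset n u v) mod n))#}" u n] by simp
qed

text \<open>The comprehensions defining the offsets unfold to \<open>concat\<close> of a
  \<open>map\<close>; exchanging the sums lets every cyclic pair be treated separately.\<close>

lemma sum_image_mset_concat_map:
  "(\<Sum>i\<in>I. image_mset (F i) (mset (concat (map g L))))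
    = (\<Sum>p\<leftarrow>L. \<Sum>i\<in>I. image_mset (F i) (mset (g p)))"
  by (induction L) (simp_all add: sum.distrib)

text \<open>Over all shifts, a single cyclic pair sweeps out one full family of edges with a fixed
  offset. The signs of its two letters decide to which of the three kinds the family
  belongs.\<close>

lemma sum_edges_shifted_pairs:
  assumes "\<And>x y. (x, y) \<in> set L \<Longrightarrow> {x, y} \<subseteq> Pos ` {..<n} \<union> Neg ` {..<n}"
  shows "(\<Sum>i<n. image_mset (\<lambda>(x, y). Upair x (linv y))
          (mset (map (map_prod (map_letter (\<lambda>x. (x + i) mod n)) (map_letter (\<lambda>x. (x + i) mod n))) L)))
    = (\<Sum>i<n. {# Upair (Pos i) (Pos ((i + a) mod n)).
                  a \<in># mset [offset n i j. (Pos i, Neg j) \<leftarrow> L] #} +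
               {# Upair (Neg i) (Neg ((i + b) mod n)).
                  b \<in># mset [offset n i j. (Neg i, Pos j) \<leftarrow> L] #} +
               {# Upair (Pos i) (Neg ((i + q) mod n)).
                  q \<in># mset [offset n i j. (Pos i, Pos j) \<leftarrow> L] +
                       mset [offset n i j. (Neg j, Neg i) \<leftarrow> L] #})"
    (is "?lhs = ?rhs")
proof -
  define G where "G = (\<lambda>i. (\<lambda>(x, y). Upair x (linv y)) \<circ>
    map_prod (map_letter (\<lambda>x. (x + i) mod n)) (map_letter (\<lambda>x. (x + i) mod n)))"
  \<comment> \<open>A pair of two negative letters yields edges read from their negative end.
    Reading them from the positive end reverses the offset, which matches the convention for
    \<open>Q\<close>.\<close>
  have flip: "(\<Sum>i<n. {#Upair (Neg i) (Pos ((i + offset n u v) mod n))#})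
      = (\<Sum>i<n. {#Upair (Pos i) (Neg ((i + offset n v u) mod n))#})" if "u < n" "v < n" for u v
  proof -
    have "Upair (Neg a) (Pos b) = Upair (Pos b) (Neg a)" for a b :: nat by simp
    then have "(\<Sum>i<n. {#Upair (Neg ((u + i) mod n)) (Pos ((v + i) mod n))#})
        = (\<Sum>i<n. {#Upair (Pos ((v + i) mod n)) (Neg ((u + i) mod n))#})"
      by presburger
    then show ?thesis using that by (simp add: sum_edges_shifted_pair)
  qed
  have "?lhs = (\<Sum>i<n. image_mset (G i) (mset (concat (map (\<lambda>p. [p]) L))))"
    by (simp add: G_def multiset.map_comp)
  also have "\<dots> = (\<Sum>p\<leftarrow>L. \<Sum>i<n. {#G i p#})"
    unfolding sum_image_mset_concat_map by simp
  also have "\<dots> = (\<Sum>p\<leftarrow>L.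
      (\<Sum>i<n. {# Upair (Pos i) (Pos ((i + a) mod n)).
        a \<in># mset (case p of (Pos i, Neg j) \<Rightarrow> [offset n i j] | _ \<Rightarrow> []) #}) +
      (\<Sum>i<n. {# Upair (Neg i) (Neg ((i + b) mod n)).
        b \<in># mset (case p of (Neg i, Pos j) \<Rightarrow> [offset n i j] | _ \<Rightarrow> []) #}) +
      ((\<Sum>i<n. {# Upair (Pos i) (Neg ((i + q) mod n)).
        q \<in># mset (case p of (Pos i, Pos j) \<Rightarrow> [offset n i j] | _ \<Rightarrow> []) #}) +
       (\<Sum>i<n. {# Upair (Pos i) (Neg ((i + q) mod n)).
        q \<in># mset (case p of (Neg j, Neg i) \<Rightarrow> [offset n i j] | _ \<Rightarrow> []) #})))"
  proof (intro arg_cong[where f = sum_list] map_cong refl)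
    fix p assume "p \<in> set L"
    moreover obtain x y where p: "p = (x, y)" by fastforce
    ultimately have "x \<in> Pos ` {..<n} \<union> Neg ` {..<n}" "y \<in> Pos ` {..<n} \<union> Neg ` {..<n}"
      using assms[of x y] by simp_all
    then show "(\<Sum>i<n. {#G i p#}) =
      (\<Sum>i<n. {# Upair (Pos i) (Pos ((i + a) mod n)).
        a \<in># mset (case p of (Pos i, Neg j) \<Rightarrow> [offset n i j] | _ \<Rightarrow> []) #}) +
      (\<Sum>i<n. {# Upair (Neg i) (Neg ((i + b) mod n)).
        b \<in># mset (case p of (Neg i, Pos j) \<Rightarrow> [offset n i j] | _ \<Rightarrow> []) #}) +
      ((\<Sum>i<n. {# Upair (Pos i) (Neg ((i + q) mod n)).
        q \<in># mset (case p of (Pos i, Pos j) \<Rightarrow> [offset n i j] | _ \<Rightarrow> []) #}) +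
       (\<Sum>i<n. {# Upair (Pos i) (Neg ((i + q) mod n)).
        q \<in># mset (case p of (Neg j, Neg i) \<Rightarrow> [offset n i j] | _ \<Rightarrow> []) #}))"
      by (cases x; cases y) (auto simp: p G_def sum_edges_shifted_pair flip)
  qed
  also have "\<dots> = ?rhs"
    unfolding sum_list_addf image_mset_union sum.distrib sum_image_mset_concat_map by (rule refl)
  finally show ?thesis .
qed

text \<open>Arbitrary multisets of offsets are allowed, so that degrees and components can be
  studied without reference to a word.\<close>

definition star_edges :: "nat \<Rightarrow> nat multiset \<Rightarrow> nat multiset \<Rightarrow> nat multiset \<Rightarrow> nat letter uprod multiset"
  where "star_edges n A B Q =
    (\<Sum>i<n. {# Upair (Pos i) (Pos ((i + a) mod n)). a \<in># A #} +
            {# Upair (Neg i) (Neg ((i + b) mod n)). b \<in># B #} +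
            {# Upair (Pos i) (Neg ((i + q) mod n)). q \<in># Q #})"

lemma edges_star_graph_cyclic:
  assumes w: "w \<in> carrier (free_group {..<n})"
    and x0: "Pos 0 \<in> set w \<or> Neg 0 \<in> set w"
    and prim: "\<not> proper_power {..<n} w"
    and nonred: "non_redundant {..<n} (cyclic_relators n w)"
  shows "edges (star_graph {..<n} (cyclic_relators n w))
    = star_edges n (offsets_A n w) (offsets_B n w) (offsets_Q n w)"
proof -
  define f where "f = (\<lambda>i x. (x + i) mod n)"
  define r where "r = (\<lambda>i. map (map_letter (f i)) w)"
  have letters: "set w \<subseteq> Pos ` {..<n} \<union> Neg ` {..<n}" and red: "reduced w"
    using w by (auto simp: free_group_def)
  have n: "n > 0" and w_ne: "w \<noteq> []" using x0 letters by auto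
  have R: "cyclic_relators n w = r ` {..<n}"
    unfolding cyclic_relators_def r_def f_def funpow_shift[OF letters] by auto
  have f_inj: "inj_on (f i) {..<n}" for i
    using mod_add_left_inj by (auto intro!: inj_onI simp: f_def)
  have r_red: "reduced (r i)" for i
    unfolding r_def using reduced_map_letter[OF red f_inj letters] .
  have r_letters: "set (r i) \<subseteq> Pos ` {..<n} \<union> Neg ` {..<n}" for i
  proof -
    have "map_letter (f i) x \<in> Pos ` {..<n} \<union> Neg ` {..<n}" for x
      using n by (cases x) (auto simp: f_def)
    then show ?thesis by (auto simp: r_def)
  qed
  have carrier: "r ` {..<n} \<subseteq> carrier (free_group {..<n})"
    using r_red r_letters by (auto simp: free_group_def)
  \<comment> \<open>The shift by \<open>i\<close> sends the subscript 0 to \<open>i\<close>, so a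
    letter of \<open>w\<close> with subscript 0 reveals the amount of the shift.\<close>
  have r_neq: "i = j" if "i < n" "j < n" "r i = r j" for i j
  proof -
    obtain x where x: "x \<in> set w" "x = Pos 0 \<or> x = Neg 0" using x0 by auto
    then have "map_letter (f i) x = map_letter (f j) x"
      using that by (simp add: r_def)
    then show ?thesis using x that by (auto simp: f_def)
  qed
  have rot_inj: "i = j" if "i < n" "j < n"
      "rotate k (r i) = rotate k' (r j) \<or> rotate k (r i) = rotate k' (winv (r j))" for i j k k'
    using non_redundant_rotate_eq[OF nonred[unfolded R] carrier _ _ that(3)] that r_neq by auto
  have disj: "rotate k (r i) \<noteq> rotate k' (winv (r j))" if "i < n" "j < n" for i j k k'
  proof
    assume eq: "rotate k (r i) = rotate k' (winv (r j))"
    then have "i = j" using rot_inj that by blast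
    then obtain m where "winv (r i) = rotate m (r i)" using rotate_eq_rotate eq by blast
    then show False using rotate_neq_winv[OF r_red, of i m] w_ne by (simp add: r_def)
  qed
  \<comment> \<open>Equal rotations of \<open>r i\<close> make \<open>r i\<close> invariant under
    rotation by the difference. Injectivity of the renaming carries this period back to
    \<open>w\<close>, which is not a proper power.\<close>
  have aperiodic: "k = k'"
    if "rotate k (r i) = rotate k' (r i)" "k \<le> k'" "k' < length w" for i k k'
  proof -
    have "rotate k (rotate (k' - k) (r i)) = rotate k (r i)"
      using that by (simp add: rotate_rotate)
    then have "rotate (k' - k) (r i) = r i"
      using inj_fn[OF inj_rotate1, of k] unfolding rotate_def by (rule injD[rotated])
    then have "map (map_letter (f i)) (rotate (k' - k) w) = map (map_letter (f i)) w"
      by (simp add: r_def rotate_map)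
    then have "rotate (k' - k) w = w"
      using map_map_letter_inj[OF f_inj[of i]] letters by (metis set_rotate)
    then show ?thesis using rotate_primitive[OF w prim, of "k' - k"] that by linarith
  qed
  have inj: "inj_on (\<lambda>p. rotate (snd p) (r (fst p))) ({..<n} \<times> {..<length w})"
  proof (rule inj_onI)
    fix p p' assume p: "p \<in> {..<n} \<times> {..<length w}" "p' \<in> {..<n} \<times> {..<length w}"
      and eq: "rotate (snd p) (r (fst p)) = rotate (snd p') (r (fst p'))"
    then have fst: "fst p = fst p'" using rot_inj by (auto simp: mem_Times_iff)
    moreover have "snd p = snd p'"
      using aperiodic[of "snd p" "fst p" "snd p'"] aperiodic[of "snd p'" "fst p" "snd p"] eq fst p
      by (cases "snd p \<le> snd p'") (auto simp: mem_Times_iff)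
    ultimately show "p = p'" by (simp add: prod_eq_iff)
  qed
  have len: "length (r i) = length w" for i by (simp add: r_def)
  have pairs: "{x, y} \<subseteq> Pos ` {..<n} \<union> Neg ` {..<n}"
    if "(x, y) \<in> set (cyclic_pairs w)" for x y
    using that letters set_zip_leftD[of x y w] set_zip_rightD[of x y w "rotate1 w"]
    by (auto simp: cyclic_pairs_def)
  have "edges (star_graph {..<n} (cyclic_relators n w))
      = (\<Sum>i<n. image_mset (\<lambda>(x, y). Upair x (linv y)) (mset (cyclic_pairs (r i))))"
    unfolding R using len w_ne inj disj by (intro edges_star_graph) auto
  also have "\<dots> = star_edges n (offsets_A n w) (offsets_B n w) (offsets_Q n w)"
    unfolding star_edges_def offsets_A_def offsets_B_def offsets_Q_def r_def f_def cyclic_pairs_map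
    using pairs by (rule sum_edges_shifted_pairs)
  finally show ?thesis .
qed

section \<open>Degrees\<close>

lemma image_mset_sum: "image_mset f (\<Sum>i\<in>I. M i) = (\<Sum>i\<in>I. image_mset f (M i))"
  by (induction I rule: infinite_finite_induct) auto

lemma sum_sum_mset_swap:
  fixes g :: "'a \<Rightarrow> 'b \<Rightarrow> 'c::comm_monoid_add"
  shows "(\<Sum>i\<in>I. \<Sum>a\<in>#A. g i a) = (\<Sum>a\<in>#A. \<Sum>i\<in>I. g i a)"
  by (induction A) (auto simp: sum.distrib)

lemma sum_mset_sum: "sum_mset (\<Sum>i\<in>I. M i) = (\<Sum>i\<in>I. sum_mset (M i))"
  by (induction I rule: infinite_finite_induct) auto

text \<open>Adding \<open>a\<close> permutes the residues, so the indicator of \<open>k\<close> has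
  the same sum before and after the shift.\<close>

lemma card_add_mod_eq:
  fixes k n a :: nat
  assumes "k < n"
  shows "card ({..<n} \<inter> {i. k = (i + a) mod n}) = 1"
  using sum_shift_mod[of "\<lambda>i. of_bool (k = i) :: nat" a n] assms
  by (simp add: add.commute[of a])

lemma sum_mset_const: "(\<Sum>a\<in>#A. k) = size A * (k::nat)"
  by (induction A) auto

lemma degree_star_edges:
  assumes "edges G = star_edges n A B Q" "k < n"
  shows "degree G (Pos k) = 2 * size A + size Q" "degree G (Neg k) = 2 * size B + size Q"
proof -
  \<comment> \<open>Counting the two ends separately covers loops and other edges uniformly: a loop
    is met by both indicators.\<close>
  have inc: "(if Upair x y = Upair v v then 2 else if v \<in> set_uprod (Upair x y) then 1 else 0)
      = (of_bool (v = x) + of_bool (v = y) :: nat)" for v x y :: "nat letter"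
    by auto
  have deg: "degree G v =
    (\<Sum>a\<in>#A. \<Sum>i<n. of_bool (v = Pos i) + of_bool (v = Pos ((i + a) mod n))) +
    (\<Sum>b\<in>#B. \<Sum>i<n. of_bool (v = Neg i) + of_bool (v = Neg ((i + b) mod n))) +
    (\<Sum>q\<in>#Q. \<Sum>i<n. of_bool (v = Pos i) + of_bool (v = Neg ((i + q) mod n)))" for v
    unfolding degree_def assms(1) star_edges_def
    by (simp only: image_mset_sum sum_mset_sum image_mset_union sum_mset.union multiset.map_comp
        comp_def inc sum.distrib sum_sum_mset_swap)
  show "degree G (Pos k) = 2 * size A + size Q" "degree G (Neg k) = 2 * size B + size Q"
    using assms(2) by (simp_all add: deg sum.distrib card_add_mod_eq sum_mset_const)
qed

text \<open>The positive letters of \<open>w\<close> can be counted as first or as second entries of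
  the cyclic pairs. Comparing the counts gives equally many pairs of type \<open>A\<close> and of
  type \<open>B\<close>, and all types together number \<open>length w\<close>.\<close>

lemma size_offsets:
  "2 * size (offsets_A n w) + size (offsets_Q n w) = length w"
  "2 * size (offsets_B n w) + size (offsets_Q n w) = length w"
proof -
  define pos where "pos = (\<lambda>x :: nat letter. \<exists>i. x = Pos i)"
  have fst: "length [offset n i j. (Pos i, Neg j) \<leftarrow> L] + length [offset n i j. (Pos i, Pos j) \<leftarrow> L]
      = length (filter pos (map fst L))" for L
    by (induction L) (auto simp: pos_def split: letter.splits)
  have snd: "length [offset n i j. (Neg i, Pos j) \<leftarrow> L] + length [offset n i j. (Pos i, Pos j) \<leftarrow> L]
      = length (filter pos (map snd L))" for L
    by (induction L) (auto simp: pos_def split: letter.splits)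
  have all: "length [offset n i j. (Pos i, Neg j) \<leftarrow> L] + length [offset n i j. (Neg i, Pos j) \<leftarrow> L]
      + length [offset n i j. (Pos i, Pos j) \<leftarrow> L] + length [offset n i j. (Neg j, Neg i) \<leftarrow> L]
      = length L" for L
    by (induction L) (auto split: letter.splits)
  have "map fst (cyclic_pairs w) = w" "map snd (cyclic_pairs w) = rotate1 w"
    by (simp_all add: cyclic_pairs_def)
  moreover have "length (filter pos (rotate1 w)) = length (filter pos w)"
    by (cases w) auto
  ultimately show "2 * size (offsets_A n w) + size (offsets_Q n w) = length w"
    "2 * size (offsets_B n w) + size (offsets_Q n w) = length w"
    using fst[of "cyclic_pairs w"] snd[of "cyclic_pairs w"] all[of "cyclic_pairs w"]
    unfolding offsets_A_def offsets_B_def offsets_Q_def size_union size_mset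
    by (simp_all add: cyclic_pairs_def)
qed

section \<open>Reachability and components\<close>

lemma sym_reachable: "(u, v) \<in> reachable G \<Longrightarrow> (v, u) \<in> reachable G"
proof -
  have "sym {(u, v). Upair u v \<in># edges G}"
  proof (rule symI)
    fix u v assume "(u, v) \<in> {(u, v). Upair u v \<in># edges G}"
    moreover have "Upair u v = Upair v u" by simp
    ultimately show "(v, u) \<in> {(u, v). Upair u v \<in># edges G}" by simp
  qed
  then show "(u, v) \<in> reachable G \<Longrightarrow> (v, u) \<in> reachable G"
    unfolding reachable_def by (meson sym_rtrancl symD)
qed

lemma refl_reachable: "(u, u) \<in> reachable G"
  by (simp add: reachable_def)

lemma trans_reachable: "(u, v) \<in> reachable G \<Longrightarrow> (v, x) \<in> reachable G \<Longrightarrow> (u, x) \<in> reachable G"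
  unfolding reachable_def by (rule rtrancl_trans)

lemma edge_reachable: "Upair u v \<in># edges G \<Longrightarrow> (u, v) \<in> reachable G"
  by (auto simp: reachable_def)

text \<open>An invariant that is constant along edges is constant on components; if moreover its
  fibres are connected, the components are exactly the fibres.\<close>

lemma components_eq_fibres:
  assumes edge: "\<And>u v. Upair u v \<in># edges G \<Longrightarrow> \<kappa> u = \<kappa> v"
    and conn: "\<And>u v. u \<in> verts G \<Longrightarrow> v \<in> verts G \<Longrightarrow> \<kappa> u = \<kappa> v \<Longrightarrow> (u, v) \<in> reachable G"
  shows "components G = (\<lambda>c. induced G {v \<in> verts G. \<kappa> v = c}) ` \<kappa> ` verts G"
    and "card (components G) = card (\<kappa> ` verts G)"
proof -
  have inv: "\<kappa> u = \<kappa> v" if "(u, v) \<in> reachable G" for u v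
    using that unfolding reachable_def
    by (induction rule: rtrancl_induct) (auto dest: edge)
  have "{u \<in> verts G. (v, u) \<in> reachable G} = {u \<in> verts G. \<kappa> u = \<kappa> v}" if "v \<in> verts G" for v
    using that conn by (auto dest: inv)
  then have "(\<lambda>v. induced G {u \<in> verts G. (v, u) \<in> reachable G}) ` verts G
      = (\<lambda>v. induced G {u \<in> verts G. \<kappa> u = \<kappa> v}) ` verts G"
    by (intro image_cong) simp_all
  then have "components G = (\<lambda>v. induced G {u \<in> verts G. \<kappa> u = \<kappa> v}) ` verts G"
    unfolding components_def Setcompr_eq_image by simp
  then show eq: "components G = (\<lambda>c. induced G {v \<in> verts G. \<kappa> v = c}) ` \<kappa> ` verts G"
    by (simp add: image_image)
  \<comment> \<open>Fibres over attained values are nonempty, so different values give different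
    vertex sets.\<close>
  have "inj_on (\<lambda>c. induced G {v \<in> verts G. \<kappa> v = c}) (\<kappa> ` verts G)"
    by (rule inj_onI) (auto simp: induced_def)
  then show "card (components G) = card (\<kappa> ` verts G)"
    unfolding eq by (rule card_image)
qed

text \<open>A set of integers that contains 0 and is closed under differences is a subgroup. By
  Bezout, a subgroup containing \<open>S\<close> contains its greatest common divisor and all
  multiples of it.\<close>

lemma Gcd_in_closed_set:
  fixes H :: "int set"
  assumes "finite S" "S \<subseteq> H" "0 \<in> H" and diff: "\<And>a b. a \<in> H \<Longrightarrow> b \<in> H \<Longrightarrow> a - b \<in> H"
  shows "k * Gcd S \<in> H"
proof -
  have neg: "- a \<in> H" if "a \<in> H" for a
    using diff[OF \<open>0 \<in> H\<close> that] by simp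
  have add: "a + b \<in> H" if "a \<in> H" "b \<in> H" for a b
    using diff[OF that(1) neg[OF that(2)]] by simp
  have "int m * a \<in> H" if "a \<in> H" for m a
    using that by (induction m) (auto simp: \<open>0 \<in> H\<close> algebra_simps add)
  then have mult: "m * a \<in> H" if "a \<in> H" for m a
    using that neg by (cases m rule: int_cases2) (auto dest: neg)
  have "Gcd S \<in> H"
    using \<open>finite S\<close> \<open>S \<subseteq> H\<close>
  proof (induction S rule: finite_induct)
    case (insert a S)
    obtain x y where "x * a + y * Gcd S = gcd a (Gcd S)"
      using bezout_int by blast
    then show ?case using insert mult add by (metis Gcd_insert insert_subset)
  qed (simp add: \<open>0 \<in> H\<close>)
  then show ?thesis by (rule mult)
qed

text \<open>The shifts that join \<open>P z\<close> to its translate for every \<open>z\<close> form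
  a subgroup \<open>H\<close>. Quantifying over all base points is what makes such shifts
  composable.\<close>

lemma reachable_Gcd:
  fixes P :: "int \<Rightarrow> 'v"
  assumes "finite S" and step: "\<And>s z. s \<in> S \<Longrightarrow> (P z, P (z + s)) \<in> reachable G"
    and "[x = y] (mod Gcd S)"
  shows "(P x, P y) \<in> reachable G"
proof -
  define H where "H = {m. \<forall>z. (P z, P (z + m)) \<in> reachable G}"
  obtain k where k: "y - x = k * Gcd S"
    using assms(3) by (metis cong_iff_dvd_diff cong_sym dvd_def mult.commute)
  have "k * Gcd S \<in> H"
  proof (rule Gcd_in_closed_set)
    fix a b assume ab: "a \<in> H" "b \<in> H"
    show "a - b \<in> H"
      unfolding H_def
    proof (intro CollectI allI)
      fix z
      have "(P z, P (z + a)) \<in> reachable G" using ab by (simp add: H_def)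
      \<comment> \<open>The path for \<open>b\<close>, started at the target, arrives at
        \<open>P (z + a)\<close> and is then traversed backwards.\<close>
      moreover have "(P (z + (a - b)), P (z + (a - b) + b)) \<in> reachable G"
        using ab unfolding H_def by blast
      ultimately show "(P z, P (z + (a - b))) \<in> reachable G"
        using trans_reachable sym_reachable by fastforce
    qed
  qed (use assms step in \<open>auto simp: H_def refl_reachable\<close>)
  then have "(P x, P (x + (y - x))) \<in> reachable G"
    unfolding k H_def by blast
  then show ?thesis by simp
qed

section \<open>Residue classes and graph isomorphisms\<close>

lemma residue_class_eq:
  fixes n d j :: nat
  assumes "d dvd n" "n > 0"
  shows "{(j + t * d) mod n | t. t < n div d} = {i. i < n \<and> [i = j] (mod d)}"
proof (intro equalityI subsetI)
  fix i assume "i \<in> {(j + t * d) mod n | t. t < n div d}"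
  then obtain t where "i = (j + t * d) mod n" by blast
  then show "i \<in> {i. i < n \<and> [i = j] (mod d)}"
    using assms by (simp add: cong_def mod_mod_cancel)
next
  fix i assume "i \<in> {i. i < n \<and> [i = j] (mod d)}"
  then have i: "i < n" and cong: "[i = j] (mod d)" by auto
  obtain m where m: "n = d * m" using assms by blast
  have "m > 0" "d > 0" using m assms by (auto intro: gr0I)
  obtain k where k: "int i - int j = int d * k"
    using cong by (metis cong_iff_dvd_diff cong_int_iff dvd_def)
  \<comment> \<open>Reducing \<open>k\<close> modulo \<open>m\<close>, which is
    \<open>n div d\<close>, brings the parameter into range and changes the multiple of
    \<open>d\<close> only by a multiple of \<open>n\<close>.\<close>
  define t where "t = nat (k mod int m)"
  have t: "int t = k mod int m" using \<open>m > 0\<close> by (simp add: t_def)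
  then have "t < m" using \<open>m > 0\<close> by (metis of_nat_0_less_iff of_nat_less_iff pos_mod_bound)
  have "[int t * int d = k * int d] (mod int m * int d)"
    unfolding t cong_def by (simp add: mod_mult_mult2)
  then have "[int j + int t * int d = int j + k * int d] (mod int n)"
    by (intro cong_add cong_refl) (simp add: m mult.commute)
  then have "[int (j + t * d) = int i] (mod int n)"
    using k by (simp add: algebra_simps)
  then have "[j + t * d = i] (mod n)" by (simp only: cong_int_iff)
  then have "(j + t * d) mod n = i" using i by (simp add: cong_def)
  moreover have "t < n div d" using \<open>t < m\<close> \<open>d > 0\<close> m by simp
  ultimately show "i \<in> {(j + t * d) mod n | t. t < n div d}" by blast
qed

lemma card_residue_class:
  fixes n d j :: nat
  assumes "d dvd n" "n > 0"
  shows "card {(j + t * d) mod n | t. t < n div d} = n div d"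
proof -
  obtain m where m: "n = d * m" using assms by blast
  have pos: "m > 0" "d > 0" using m assms by (auto intro: gr0I)
  have "inj_on (\<lambda>t. (j + t * d) mod n) {..<m}"
  proof (rule inj_onI)
    fix s t assume st: "s \<in> {..<m}" "t \<in> {..<m}" and "(j + s * d) mod n = (j + t * d) mod n"
    then have "[s * d = t * d] (mod n)" by (metis cong_def cong_add_lcancel_nat)
    then have "(s * d) mod (m * d) = (t * d) mod (m * d)" by (simp add: cong_def m mult.commute)
    then show "s = t" using st pos by (simp add: mod_mult_mult2)
  qed
  then have "card ((\<lambda>t. (j + t * d) mod n) ` {..<m}) = m"
    by (simp add: card_image)
  moreover have "{(j + t * d) mod n | t. t < n div d} = (\<lambda>t. (j + t * d) mod n) ` {..<m}"
    using pos m by auto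
  ultimately show ?thesis using pos m by simp
qed

section \<open>Walks in the star graph with integer subscripts\<close>

lemma mem_star_edges:
  "e \<in># star_edges n A B Q \<longleftrightarrow>
    (\<exists>i<n. (\<exists>a\<in>#A. e = Upair (Pos i) (Pos ((i + a) mod n))) \<or>
           (\<exists>b\<in>#B. e = Upair (Neg i) (Neg ((i + b) mod n))) \<or>
           (\<exists>q\<in>#Q. e = Upair (Pos i) (Neg ((i + q) mod n))))"
  unfolding star_edges_def by (fastforce simp: set_mset_sum)

lemma filter_mset_sum: "filter_mset P (\<Sum>i\<in>I. M i) = (\<Sum>i\<in>I. filter_mset P (M i))"
  by (induction I rule: infinite_finite_induct) auto

text \<open>Vertices with integer subscripts modulo \<open>n\<close>, so that walks may also decrease the subscript.\<close>

definition ivert :: "(nat \<Rightarrow> nat letter) \<Rightarrow> nat \<Rightarrow> int \<Rightarrow> nat letter" where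
  "ivert c n z = c (nat (z mod int n))"

lemma ivert_int: "i < n \<Longrightarrow> ivert c n (int i) = c i"
  by (simp add: ivert_def flip: zmod_int)

lemma ivert_add:
  assumes "n > 0"
  shows "ivert c n (z + int a) = c ((nat (z mod int n) + a) mod n)"
proof -
  have "int ((nat (z mod int n) + a) mod n) = (z + int a) mod int n"
    using assms by (simp add: zmod_int mod_simps)
  then show ?thesis unfolding ivert_def by (metis nat_int)
qed

lemma ivert_edge:
  assumes "n > 0"
  shows "a \<in># A \<Longrightarrow> Upair (ivert Pos n z) (ivert Pos n (z + int a)) \<in># star_edges n A B Q"
    and "b \<in># B \<Longrightarrow> Upair (ivert Neg n z) (ivert Neg n (z + int b)) \<in># star_edges n A B Q"
    and "q \<in># Q \<Longrightarrow> Upair (ivert Pos n z) (ivert Neg n (z + int q)) \<in># star_edges n A B Q"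
proof -
  have "nat (z mod int n) < n" using assms by (simp add: nat_less_iff)
  then show "a \<in># A \<Longrightarrow> Upair (ivert Pos n z) (ivert Pos n (z + int a)) \<in># star_edges n A B Q"
    and "b \<in># B \<Longrightarrow> Upair (ivert Neg n z) (ivert Neg n (z + int b)) \<in># star_edges n A B Q"
    and "q \<in># Q \<Longrightarrow> Upair (ivert Pos n z) (ivert Neg n (z + int q)) \<in># star_edges n A B Q"
    unfolding mem_star_edges ivert_add[OF assms] by (auto simp: ivert_def)
qed

lemma ivert_period: "ivert c n (z + int n) = ivert c n z"
  by (simp add: ivert_def)

text \<open>An automorphism \<open>f\<close> of \<open>G\<close> restricts to an isomorphism onto
  the subgraph induced by the image. Since edges have their ends in \<open>verts G\<close>,
  injectivity there ensures that an edge lies in \<open>U\<close> exactly if its image lies in the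
  image of \<open>U\<close>.\<close>

lemma graph_isomorphic_induced:
  assumes "inj_on f (verts G)" "U \<subseteq> verts G"
    and edges: "\<And>e. e \<in># edges G \<Longrightarrow> set_uprod e \<subseteq> verts G"
    and inv: "image_mset (map_uprod f) (edges G) = edges G"
  shows "graph_isomorphic (induced G U) (induced G (f ` U))"
proof -
  have "set_uprod (map_uprod f e) \<subseteq> f ` U \<longleftrightarrow> set_uprod e \<subseteq> U" if "e \<in># edges G" for e
    using edges[OF that] inj_on_image_mem_iff[OF assms(1) _ assms(2)]
    by (simp add: uprod.set_map image_subset_iff) (metis subset_iff)
  then have "image_mset (map_uprod f) {#e \<in># edges G. set_uprod e \<subseteq> U#}
      = image_mset (map_uprod f) {#e \<in># edges G. set_uprod (map_uprod f e) \<subseteq> f ` U#}"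
    by (metis (no_types, lifting) filter_mset_cong)
  also have "\<dots> = {#e \<in># image_mset (map_uprod f) (edges G). set_uprod e \<subseteq> f ` U#}"
    by (simp add: filter_mset_image_mset)
  finally have "image_mset (map_uprod f) {#e \<in># edges G. set_uprod e \<subseteq> U#}
      = {#e \<in># edges G. set_uprod e \<subseteq> f ` U#}"
    by (simp add: inv)
  moreover have "bij_betw f U (f ` U)"
    using assms by (meson bij_betw_imageI inj_on_subset)
  ultimately show ?thesis
    unfolding graph_isomorphic_def by (intro exI[of _ f]) (simp add: induced_def)
qed

text \<open>The shift by \<open>c\<close> only permutes the summands of \<open>star_edges\<close>,
  so it acts on the star graph as an automorphism.\<close>

lemma star_edges_shift:
  "image_mset (map_uprod (map_letter (\<lambda>x. (x + c) mod n))) (star_edges n A B Q) = star_edges n A B Q"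
proof -
  define M where "M = (\<lambda>i. {# Upair (Pos i) (Pos ((i + a) mod n)). a \<in># A #} +
            {# Upair (Neg i) (Neg ((i + b) mod n)). b \<in># B #} +
            {# Upair (Pos i) (Neg ((i + q) mod n)). q \<in># Q #})"
  have "((i + a) mod n + c) mod n = ((c + i) mod n + a) mod n" for i a
    by (simp add: mod_simps add_ac)
  then have "image_mset (map_uprod (map_letter (\<lambda>x. (x + c) mod n))) (M i) = M ((c + i) mod n)" for i
    by (simp add: M_def multiset.map_comp comp_def add.commute[of c])
  moreover have "star_edges n A B Q = (\<Sum>i<n. M i)"
    by (simp add: star_edges_def M_def)
  ultimately show ?thesis
    using sum_shift_mod[of M c n] by (simp add: image_mset_sum)
qed

text \<open>The isomorphism sends the vertex with subscript \<open>j + t * d\<close> to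
  \<open>t\<close>. The parameter \<open>c\<close> stands for either sign, and \<open>E\<close>
  collects the edges that are not entirely of this sign.\<close>

lemma circulant_isomorphic:
  fixes c :: "nat \<Rightarrow> 'v"
  assumes d: "d dvd n" "n > 0" and A: "\<And>a. a \<in># A \<Longrightarrow> d dvd a" and "inj c" "j < d"
    and edges: "edges G = (\<Sum>i<n. {#Upair (c i) (c ((i + a) mod n)). a \<in># A#}) + E"
    and E: "\<And>e. e \<in># E \<Longrightarrow> \<not> set_uprod e \<subseteq> range c"
  shows "graph_isomorphic (induced G {c ((j + t * d) mod n) | t. t < n div d})
    (circulant (n div d) {#a div d. a \<in># A#})"
proof -
  obtain m where m: "n = d * m" using d by blast
  have pos: "m > 0" "d > 0" using m d by (auto intro: gr0I)
  \<comment> \<open>Since \<open>j < d\<close>, the number on the right stays below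
    \<open>n\<close>; reduction modulo \<open>n\<close> therefore acts on \<open>t\<close> alone, as
    reduction modulo \<open>m\<close>.\<close>
  have mod_n: "(j + t * d) mod n = j + (t mod m) * d" for t
  proof -
    have "j + t * d = (j + (t mod m) * d) + (t div m) * n"
      by (subst div_mult_mod_eq[of t m, symmetric]) (simp only: m algebra_simps)
    moreover have "j + (t mod m) * d < n"
    proof -
      have "Suc (t mod m) * d \<le> m * d"
        using pos by (intro mult_le_mono1) (simp add: Suc_leI)
      then show ?thesis using \<open>j < d\<close> by (simp add: m mult.commute)
    qed
    ultimately show ?thesis by (metis mod_less mod_mult_self1)
  qed
  define S where "S = (\<lambda>t. j + t * d) ` {..<m}"
  define f where "f = (\<lambda>v. inv_into UNIV c v div d)"
  have f: "f (c (j + t * d)) = t" for t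
    using \<open>inj c\<close> \<open>j < d\<close> pos by (simp add: f_def)
  have S_eq: "S = (\<lambda>t. (j + t * d) mod n) ` {..<m}"
    by (simp add: S_def mod_n cong: image_cong_simp)
  have div_eq: "n div d = m" using pos m by simp
  have U: "{c ((j + t * d) mod n) | t. t < n div d} = c ` S"
    unfolding S_eq div_eq by auto
  have S: "i \<in> S \<longleftrightarrow> i < n \<and> [i = j] (mod d)" for i
  proof -
    have "S = {(j + t * d) mod n | t. t < n div d}"
      unfolding S_eq div_eq by auto
    then show ?thesis using residue_class_eq[OF d, of j] by simp
  qed
  have bij: "bij_betw f (c ` S) {..<m}"
    by (rule bij_betw_byWitness[where f' = "\<lambda>t. c (j + t * d)"]) (auto simp: S_def f)
  have E_empty: "{#e \<in># E. set_uprod e \<subseteq> c ` S#} = {#}"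
    using E image_mono[OF subset_UNIV, of c S] by (simp add: filter_mset_eq_mempty_iff) (metis subset_trans)
  \<comment> \<open>As \<open>d\<close> divides every \<open>a\<close>, both ends of an edge lie in
    the same residue class. The restriction to \<open>S\<close> thus keeps or drops all edges
    starting at \<open>i\<close>.\<close>
  have filter: "{#e \<in># {#Upair (c i) (c ((i + a) mod n)). a \<in># A#}. set_uprod e \<subseteq> c ` S#}
      = (if i \<in> S then {#Upair (c i) (c ((i + a) mod n)). a \<in># A#} else {#})" if "i < n" for i
  proof -
    have "set_uprod (Upair (c i) (c ((i + a) mod n))) \<subseteq> c ` S \<longleftrightarrow> i \<in> S" if "a \<in># A" for a
    proof -
      have "[i + a = i] (mod d)" using A[OF that] by (simp add: cong_def mod_add_right_eq[symmetric] del: mod_add_right_eq)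
      then have "[(i + a) mod n = i] (mod d)"
        using d by (simp add: cong_def mod_mod_cancel)
      then have "(i + a) mod n \<in> S \<longleftrightarrow> i \<in> S"
        using S \<open>i < n\<close> \<open>n > 0\<close> by (auto intro: cong_trans cong_sym)
      then show ?thesis using \<open>inj c\<close> by (auto simp: inj_image_mem_iff)
    qed
    then have "{#e \<in># {#Upair (c i) (c ((i + a) mod n)). a \<in># A#}. set_uprod e \<subseteq> c ` S#}
        = {#e \<in># {#Upair (c i) (c ((i + a) mod n)). a \<in># A#}. i \<in> S#}"
      by (intro filter_mset_cong) auto
    then show ?thesis by simp
  qed
  have "{#e \<in># edges G. set_uprod e \<subseteq> c ` S#}
      = (\<Sum>i<n. if i \<in> S then {#Upair (c i) (c ((i + a) mod n)). a \<in># A#} else {#})"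
    unfolding edges filter_union_mset filter_mset_sum E_empty add_0_right
    by (rule sum.cong) (simp_all only: lessThan_iff filter)
  also have "\<dots> = (\<Sum>i\<in>S. {#Upair (c i) (c ((i + a) mod n)). a \<in># A#})"
    by (rule sum.mono_neutral_cong_right) (auto simp: S)
  also have "\<dots> = (\<Sum>t<m. {#Upair (c (j + t * d)) (c ((j + t * d + a) mod n)). a \<in># A#})"
    unfolding S_def using pos by (subst sum.reindex) (auto simp: inj_on_def)
  finally have "image_mset (map_uprod f) {#e \<in># edges G. set_uprod e \<subseteq> c ` S#}
      = (\<Sum>t<m. {#Upair t (f (c ((j + t * d + a) mod n))). a \<in># A#})"
    by (simp add: image_mset_sum multiset.map_comp comp_def f)
  also have "\<dots> = (\<Sum>t<m. {#Upair t ((t + a div d) mod m). a \<in># A#})"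
  proof (intro sum.cong refl image_mset_cong arg_cong2[where f = Upair])
    fix t a assume "a \<in># A"
    then have "j + t * d + a = j + (t + a div d) * d"
      using A by (simp add: algebra_simps)
    then show "f (c ((j + t * d + a) mod n)) = (t + a div d) mod m"
      by (simp only: mod_n f)
  qed
  finally show ?thesis
    unfolding U graph_isomorphic_def using bij pos m
    by (intro exI[of _ f]) (simp add: induced_def circulant_def multiset.map_comp comp_def)
qed

section \<open>Components\<close>

lemma edge_class_eqI:
  assumes "\<And>i a. i < n \<Longrightarrow> a \<in># A \<Longrightarrow> \<kappa> (Pos i) = \<kappa> (Pos ((i + a) mod n))"
    and "\<And>i b. i < n \<Longrightarrow> b \<in># B \<Longrightarrow> \<kappa> (Neg i) = \<kappa> (Neg ((i + b) mod n))"
    and "\<And>i q. i < n \<Longrightarrow> q \<in># Q \<Longrightarrow> \<kappa> (Pos i) = \<kappa> (Neg ((i + q) mod n))"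
    and "Upair u v \<in># star_edges n A B Q"
  shows "\<kappa> u = \<kappa> v"
proof -
  obtain x y where "Upair u v = Upair x y" "\<kappa> x = \<kappa> y"
    using assms(4) unfolding mem_star_edges by (metis assms(1-3))
  then show ?thesis by auto
qed

lemma residue_vertices_eq:
  fixes c :: "nat \<Rightarrow> 'v"
  assumes "d dvd n" "n > (0::nat)"
  shows "{c ((j + t * d) mod n) | t. t < n div d} = c ` {i. i < n \<and> [i = j] (mod d)}"
  unfolding residue_class_eq[OF assms, symmetric] by auto

lemma card_residue_vertices:
  fixes c :: "nat \<Rightarrow> 'v"
  assumes "d dvd n" "n > (0::nat)" "inj c"
  shows "card {c ((j + t * d) mod n) | t. t < n div d} = n div d"
proof -
  have "{c ((j + t * d) mod n) | t. t < n div d} = c ` {(j + t * d) mod n | t. t < n div d}"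
    by auto
  then show ?thesis
    using card_residue_class[OF assms(1,2), of j] assms(3) by (simp add: card_image inj_on_subset)
qed

lemma set_uprod_star_edges:
  assumes "e \<in># star_edges n A B Q"
  shows "set_uprod e \<subseteq> Pos ` {..<n} \<union> Neg ` {..<n}"
  using assms unfolding mem_star_edges by auto

text \<open>The integer greatest common divisor is used because the differences
  \<open>int q - int q0\<close> may be negative. The components are isomorphic since a shift of
  subscripts carries one onto another.\<close>

lemma nonalternating_components:
  fixes n :: nat and q0 :: nat
  assumes n: "n > 0" and V: "verts \<Gamma> = Pos ` {..<n} \<union> Neg ` {..<n}"
    and edges: "edges \<Gamma> = star_edges n A B Q" and q0: "q0 \<in># Q"
    and d: "d = nat (Gcd ({int n} \<union> int ` set_mset A \<union> int ` set_mset B \<union>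
                        {int q - int q0 | q. q \<in># Q}))"
    and U: "U = (\<lambda>j. {Pos ((j + t * d) mod n) | t. t < n div d} \<union>
                     {Neg ((j + q0 + t * d) mod n) | t. t < n div d})"
  shows "d dvd n" "d > 0"
    and "components \<Gamma> = (\<lambda>j. induced \<Gamma> (U j)) ` {..<d}" "card (components \<Gamma>) = d"
    and "j < d \<Longrightarrow> k < d \<Longrightarrow> graph_isomorphic (induced \<Gamma> (U j)) (induced \<Gamma> (U k))"
proof -
  define S where "S = {int n} \<union> int ` set_mset A \<union> int ` set_mset B \<union>
                        {int q - int q0 | q. q \<in># Q}"
  have int_d: "int d = Gcd S" by (simp add: d S_def)
  have dvd: "int d dvd s" if "s \<in> S" for s
    unfolding int_d using that by (rule Gcd_dvd)
  have "int d dvd int n" by (rule dvd) (simp add: S_def)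
  then show dn: "d dvd n" by simp
  then show d_pos: "d > 0" using n by (auto intro: gr0I)
  \<comment> \<open>Subtracting \<open>q0\<close> on the negative side gives both ends of an edge
    with offset \<open>q0\<close> the same value; any other \<open>q\<close> differs from
    \<open>q0\<close> by a multiple of \<open>d\<close>.\<close>
  define \<kappa> where "\<kappa> = case_letter (\<lambda>i. int i mod int d) (\<lambda>i. (int i - int q0) mod int d)"
  have mod_n: "int d dvd int (x mod n) - int x" for x
    using dn by (metis mod_eq_dvd_iff mod_mod_cancel of_nat_dvd_iff zmod_int)
  have edge: "\<kappa> u = \<kappa> v" if "Upair u v \<in># edges \<Gamma>" for u v
  proof (rule edge_class_eqI[OF _ _ _ that[unfolded edges]])
    fix i a assume "a \<in># A"
    then have "int d dvd int a" by (intro dvd) (simp add: S_def)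
    then have "int d dvd (int ((i + a) mod n) - int (i + a)) + int a"
      using mod_n by (rule dvd_add[rotated])
    then show "\<kappa> (Pos i) = \<kappa> (Pos ((i + a) mod n))"
      by (intro sym[of "\<kappa> (Pos ((i + a) mod n))"]) (simp add: \<kappa>_def mod_eq_dvd_iff)
  next
    fix i b assume "b \<in># B"
    then have "int d dvd int b" by (intro dvd) (simp add: S_def)
    then have "int d dvd (int ((i + b) mod n) - int (i + b)) + int b"
      using mod_n by (rule dvd_add[rotated])
    then show "\<kappa> (Neg i) = \<kappa> (Neg ((i + b) mod n))"
      by (intro sym[of "\<kappa> (Neg ((i + b) mod n))"]) (simp add: \<kappa>_def mod_eq_dvd_iff)
  next
    fix i q assume "q \<in># Q"
    then have "int d dvd int q - int q0" by (intro dvd) (auto simp: S_def)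
    then have "int d dvd (int ((i + q) mod n) - int (i + q)) + (int q - int q0)"
      using mod_n by (rule dvd_add[rotated])
    then show "\<kappa> (Pos i) = \<kappa> (Neg ((i + q) mod n))"
      by (intro sym[of "\<kappa> (Neg ((i + q) mod n))"]) (simp add: \<kappa>_def mod_eq_dvd_iff algebra_simps)
  qed
  define P N where "P = ivert Pos n" and "N = ivert Neg n"
  have NP: "(N z, P (z - int q)) \<in> reachable \<Gamma>" if "q \<in># Q" for z q
  proof -
    have "Upair (P (z - int q)) (N z) \<in># edges \<Gamma>"
      using ivert_edge(3)[OF n that, of "z - int q" A B] by (simp add: P_def N_def edges)
    then show ?thesis by (rule sym_reachable[OF edge_reachable])
  qed
  have step: "(P z, P (z + s)) \<in> reachable \<Gamma>" if s: "s \<in> S" for s z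
  proof -
    consider "s = int n" | a where "a \<in># A" "s = int a" | b where "b \<in># B" "s = int b"
      | q where "q \<in># Q" "s = int q - int q0"
      using s by (auto simp: S_def)
    then show ?thesis
    proof cases
      case 1
      then show ?thesis by (simp add: P_def ivert_period refl_reachable)
    next
      case 2
      then show ?thesis using ivert_edge(1)[OF n] edges by (auto simp: P_def intro: edge_reachable)
    next
      \<comment> \<open>An offset of type \<open>B\<close> moves a positive vertex by crossing to
        the negative side along a \<open>q0\<close> edge, taking the step there and crossing
        back.\<close>
      case 3
      then have "(N (z + int q0), N (z + int q0 + s)) \<in> reachable \<Gamma>"
        using ivert_edge(2)[OF n] edges by (auto simp: N_def intro: edge_reachable)
      moreover have "(N (z + int q0), P z) \<in> reachable \<Gamma>"
        "(N (z + int q0 + s), P (z + s)) \<in> reachable \<Gamma>"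
        using NP[OF q0, of "z + int q0"] NP[OF q0, of "z + int q0 + s"] by (simp_all add: algebra_simps)
      ultimately show ?thesis by (meson sym_reachable trans_reachable)
    next
      \<comment> \<open>A \<open>q\<close> edge out and a \<open>q0\<close> edge back shift a
        positive vertex by \<open>q - q0\<close>.\<close>
      case 4
      have eq: "z + int q - int q0 = z + s" using 4 by simp
      have "(N (z + int q), P z) \<in> reachable \<Gamma>"
        using NP[OF 4(1), of "z + int q"] by simp
      moreover have "(N (z + int q), P (z + s)) \<in> reachable \<Gamma>"
        using NP[OF q0, of "z + int q"] unfolding eq .
      ultimately show ?thesis by (meson sym_reachable trans_reachable)
    qed
  qed
  have fin: "finite S" by (simp add: S_def)
  \<comment> \<open>Every negative vertex is joined to a positive one by a \<open>q0\<close> edge,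
    so connectivity of the fibres need only be shown between positive vertices.\<close>
  have to_P: "\<exists>z. (u, P z) \<in> reachable \<Gamma> \<and> \<kappa> u = z mod int d" if "u \<in> verts \<Gamma>" for u
  proof (cases u)
    case (Pos i)
    then have "P (int i) = u" "\<kappa> u = int i mod int d"
      using that by (auto simp: V P_def ivert_int \<kappa>_def)
    then show ?thesis by (metis refl_reachable)
  next
    case (Neg i)
    then have "N (int i) = u" "\<kappa> u = (int i - int q0) mod int d"
      using that by (auto simp: V N_def ivert_int \<kappa>_def)
    then show ?thesis using NP[OF q0, of "int i"] by auto
  qed
  have conn: "(u, v) \<in> reachable \<Gamma>" if uv: "u \<in> verts \<Gamma>" "v \<in> verts \<Gamma>" "\<kappa> u = \<kappa> v" for u v
  proof -
    obtain y z where "(u, P y) \<in> reachable \<Gamma>" "(v, P z) \<in> reachable \<Gamma>" "y mod int d = z mod int d"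
      using to_P[OF uv(1)] to_P[OF uv(2)] uv(3) by auto
    moreover from this have "(P y, P z) \<in> reachable \<Gamma>"
      using reachable_Gcd[OF fin step, of y z] by (simp add: cong_def int_d)
    ultimately show ?thesis by (meson sym_reachable trans_reachable)
  qed
  have U_eq: "U j = Pos ` {i. i < n \<and> [i = j] (mod d)} \<union> Neg ` {i. i < n \<and> [i = j + q0] (mod d)}" for j
    unfolding U residue_vertices_eq[OF dn n] ..
  have fibre: "{v \<in> verts \<Gamma>. \<kappa> v = int j} = U j" if "j < d" for j
  proof -
    have "int i mod int d = int j \<longleftrightarrow> [i = j] (mod d)" for i
      using that by (simp add: cong_def flip: zmod_int)
    moreover have "(int i - int q0) mod int d = int j \<longleftrightarrow> [i = j + q0] (mod d)" for i
    proof -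
      have "(int i - int q0) mod int d = int j \<longleftrightarrow> (int i - int q0) mod int d = int j mod int d"
        using that by simp
      also have "\<dots> \<longleftrightarrow> [int i = int (j + q0)] (mod int d)"
        by (simp add: mod_eq_dvd_iff cong_iff_dvd_diff algebra_simps)
      finally show ?thesis by (simp only: cong_int_iff)
    qed
    ultimately show ?thesis unfolding U_eq V by (auto simp: \<kappa>_def)
  qed
  have classes: "\<kappa> ` verts \<Gamma> = int ` {..<d}"
  proof (intro equalityI subsetI)
    fix x assume "x \<in> \<kappa> ` verts \<Gamma>"
    then obtain z where "x = z mod int d" using to_P by blast
    then have "x = int (nat x)" "nat x < d" using d_pos by (simp_all add: nat_less_iff)
    then show "x \<in> int ` {..<d}" by blast
  next
    fix x assume "x \<in> int ` {..<d}"
    then obtain j where j: "j < d" "x = int j" by auto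
    then have "Pos j \<in> verts \<Gamma>" "\<kappa> (Pos j) = x"
      using dvd_imp_le[OF dn n] by (auto simp: V \<kappa>_def)
    then show "x \<in> \<kappa> ` verts \<Gamma>" by blast
  qed
  have "components \<Gamma> = (\<lambda>c. induced \<Gamma> {v \<in> verts \<Gamma>. \<kappa> v = c}) ` \<kappa> ` verts \<Gamma>"
    using edge conn by (rule components_eq_fibres(1))
  then show "components \<Gamma> = (\<lambda>j. induced \<Gamma> (U j)) ` {..<d}"
    using fibre by (simp add: classes image_image)
  have "card (components \<Gamma>) = card (\<kappa> ` verts \<Gamma>)"
    using edge conn by (rule components_eq_fibres(2))
  then show "card (components \<Gamma>) = d"
    by (simp add: classes card_image)
  show "graph_isomorphic (induced \<Gamma> (U j)) (induced \<Gamma> (U k))" if "j < d" "k < d"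
  proof -
    \<comment> \<open>This is the shift by \<open>k - j\<close>; adding \<open>n\<close> first keeps
      the natural subtraction exact.\<close>
    define f where "f = map_letter (\<lambda>x. (x + (n + k - j)) mod n)"
    have "j \<le> n" using that dvd_imp_le[OF dn n] by simp
    then have "j + x + (n + k - j) = k + x + n" for x by simp
    then have shift: "((j + x) mod n + (n + k - j)) mod n = (k + x) mod n" for x
      by (metis mod_add_left_eq mod_add_self2)
    have "f ` U j = U k"
      unfolding U f_def image_Un setcompr_eq_image image_image letter.map add.assoc shift ..
    moreover have "graph_isomorphic (induced \<Gamma> (U j)) (induced \<Gamma> (f ` U j))"
    proof (rule graph_isomorphic_induced)
      have "inj_on (\<lambda>x. (x + (n + k - j)) mod n) {..<n}"
        using mod_add_left_inj by (auto intro!: inj_onI)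
      then show "inj_on f (verts \<Gamma>)" unfolding f_def V by (rule map_letter_inj_on)
      show "U j \<subseteq> verts \<Gamma>" by (auto simp: U_eq V)
      show "image_mset (map_uprod f) (edges \<Gamma>) = edges \<Gamma>"
        unfolding edges f_def by (rule star_edges_shift)
    qed (simp add: edges V set_uprod_star_edges)
    ultimately show ?thesis by simp
  qed
qed

text \<open>Without offsets in \<open>Q\<close> no edge joins vertices of opposite sign, so each
  sign contributes its own residue classes as components.\<close>

lemma alternating_components:
  fixes n :: nat
  assumes n: "n > 0" and V: "verts \<Gamma> = Pos ` {..<n} \<union> Neg ` {..<n}"
    and edges: "edges \<Gamma> = star_edges n A B {#}"
    and dA: "dA = Gcd (insert n (set_mset A))" and dB: "dB = Gcd (insert n (set_mset B))"
    and UA: "UA = (\<lambda>j. {Pos ((j + t * dA) mod n) | t. t < n div dA})"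
    and UB: "UB = (\<lambda>j. {Neg ((j + t * dB) mod n) | t. t < n div dB})"
  shows "components \<Gamma> = (\<lambda>j. induced \<Gamma> (UA j)) ` {..<dA} \<union> (\<lambda>j. induced \<Gamma> (UB j)) ` {..<dB}"
    and "card (components \<Gamma>) = dA + dB"
    and "j < dA \<Longrightarrow>
      graph_isomorphic (induced \<Gamma> (UA j)) (circulant (n div dA) {#a div dA. a \<in># A#})"
    and "j < dB \<Longrightarrow>
      graph_isomorphic (induced \<Gamma> (UB j)) (circulant (n div dB) {#b div dB. b \<in># B#})"
proof -
  have dvd: "dA dvd n" "dB dvd n" "\<And>a. a \<in># A \<Longrightarrow> dA dvd a" "\<And>b. b \<in># B \<Longrightarrow> dB dvd b"
    unfolding dA dB by (auto intro!: Gcd_dvd simp del: Gcd_insert)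
  then have pos: "dA > 0" "dB > 0" using n by (auto intro: gr0I)
  \<comment> \<open>The sum type keeps the values of the two signs disjoint, so the numbers of
    classes add up.\<close>
  define \<kappa> where "\<kappa> = case_letter (\<lambda>i. Inl (i mod dA) :: nat + nat) (\<lambda>i. Inr (i mod dB))"
  have mod_eq: "(i + a) mod n mod e = i mod e" if "e dvd n" "e dvd a" for i a e :: nat
    using that by (metis add.right_neutral dvd_eq_mod_eq_0 mod_add_right_eq mod_mod_cancel)
  have edge: "\<kappa> u = \<kappa> v" if "Upair u v \<in># edges \<Gamma>" for u v
    by (rule edge_class_eqI[OF _ _ _ that[unfolded edges]]) (simp_all add: \<kappa>_def mod_eq dvd)
  have conn_class: "(c i, c k) \<in> reachable \<Gamma>"
    if "i < n" "k < n" "[i = k] (mod Gcd (insert n (set_mset D)))"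
      and step: "\<And>z a. a \<in># D \<Longrightarrow> Upair (ivert c n z) (ivert c n (z + int a)) \<in># edges \<Gamma>"
    for c D i k
  proof -
    have step': "(ivert c n z, ivert c n (z + s)) \<in> reachable \<Gamma>" if "s \<in> int ` insert n (set_mset D)" for z s
      using that step by (auto simp: ivert_period refl_reachable intro: edge_reachable)
    have cong: "[int i = int k] (mod Gcd (int ` insert n (set_mset D)))"
      using that(3) by (simp only: Gcd_int_eq cong_int_iff)
    have "(ivert c n (int i), ivert c n (int k)) \<in> reachable \<Gamma>"
      by (rule reachable_Gcd[OF _ step' cong]) simp_all
    then show ?thesis using that(1,2) by (simp add: ivert_int)
  qed
  have conn: "(u, v) \<in> reachable \<Gamma>" if uv: "u \<in> verts \<Gamma>" "v \<in> verts \<Gamma>" "\<kappa> u = \<kappa> v" for u v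
  proof (cases u)
    case (Pos i)
    then obtain k where "v = Pos k" using uv by (cases v) (auto simp: \<kappa>_def)
    then show ?thesis
      using Pos uv ivert_edge(1)[OF n] conn_class[of i k A Pos]
      by (auto simp: V \<kappa>_def cong_def dA edges)
  next
    case (Neg i)
    then obtain k where "v = Neg k" using uv by (cases v) (auto simp: \<kappa>_def)
    then show ?thesis
      using Neg uv ivert_edge(2)[OF n] conn_class[of i k B Neg]
      by (auto simp: V \<kappa>_def cong_def dB edges)
  qed
  have fibre: "{v \<in> verts \<Gamma>. \<kappa> v = Inl j} = UA j" if "j < dA" for j
    using that unfolding UA residue_vertices_eq[OF dvd(1) n] V by (auto simp: \<kappa>_def cong_def)
  have fibre': "{v \<in> verts \<Gamma>. \<kappa> v = Inr j} = UB j" if "j < dB" for j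
    using that unfolding UB residue_vertices_eq[OF dvd(2) n] V by (auto simp: \<kappa>_def cong_def)
  have image_mod: "(\<lambda>i. i mod e) ` {..<n} = {..<e}" if "e dvd n" "e > 0" for e
  proof (intro equalityI subsetI)
    fix j assume "j \<in> {..<e}"
    then show "j \<in> (\<lambda>i. i mod e) ` {..<n}"
      using dvd_imp_le[OF that(1) n] by (intro image_eqI[of _ _ j]) auto
  qed (use that in auto)
  have "\<kappa> ` verts \<Gamma> = Inl ` (\<lambda>i. i mod dA) ` {..<n} \<union> Inr ` (\<lambda>i. i mod dB) ` {..<n}"
    by (simp add: V \<kappa>_def image_Un image_image)
  then have classes: "\<kappa> ` verts \<Gamma> = Inl ` {..<dA} \<union> Inr ` {..<dB}"
    by (simp only: image_mod dvd pos)
  have "components \<Gamma> = (\<lambda>c. induced \<Gamma> {v \<in> verts \<Gamma>. \<kappa> v = c}) ` \<kappa> ` verts \<Gamma>"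
    using edge conn by (rule components_eq_fibres(1))
  then show "components \<Gamma> = (\<lambda>j. induced \<Gamma> (UA j)) ` {..<dA} \<union> (\<lambda>j. induced \<Gamma> (UB j)) ` {..<dB}"
    using fibre fibre' by (simp add: classes image_image image_Un)
  have "card (components \<Gamma>) = card (\<kappa> ` verts \<Gamma>)"
    using edge conn by (rule components_eq_fibres(2))
  also have "\<dots> = dA + dB"
    unfolding classes by (subst card_Un_disjoint) (auto simp: card_image)
  finally show "card (components \<Gamma>) = dA + dB" .
  have "edges \<Gamma> = (\<Sum>i<n. {#Upair (Pos i) (Pos ((i + a) mod n)). a \<in># A#}) +
    (\<Sum>i<n. {#Upair (Neg i) (Neg ((i + b) mod n)). b \<in># B#})"
    by (simp add: edges star_edges_def sum.distrib)
  \<comment> \<open>The two orders of the summands put the positive and the negative edges first,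
    respectively, as \<open>circulant_isomorphic\<close> expects.\<close>
  note split = this this[unfolded add.commute[of "\<Sum>i<n. {#Upair (Pos i) (Pos ((i + a) mod n)). a \<in># A#}"]]
  show "graph_isomorphic (induced \<Gamma> (UA j)) (circulant (n div dA) {#a div dA. a \<in># A#})" if "j < dA"
    unfolding UA using dvd(1) n dvd(3) _ that split(1)
    by (rule circulant_isomorphic) (auto simp: inj_def set_mset_sum)
  show "graph_isomorphic (induced \<Gamma> (UB j)) (circulant (n div dB) {#b div dB. b \<in># B#})" if "j < dB"
    unfolding UB using dvd(2) n dvd(4) _ that split(2)
    by (rule circulant_isomorphic) (auto simp: inj_def set_mset_sum)
qed

theorem theorem3p3:
  fixes n :: nat and w :: "nat letter list"
    and \<Gamma> :: "nat letter multigraph" and A B Q :: "nat multiset" and dA dB :: nat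
  assumes "n \<ge> 1"
    and "w \<in> carrier (free_group {..<n})"
    and "cyclically_reduced w"
    and "Pos 0 \<in> set w \<or> Neg 0 \<in> set w"
    and "\<not> proper_power {..<n} w"
    and "non_redundant {..<n} (cyclic_relators n w)"
    and "\<Gamma> = star_graph {..<n} (cyclic_relators n w)"
    and "A = offsets_A n w" and "B = offsets_B n w" and "Q = offsets_Q n w"
    and "dA = Gcd (insert n (set_mset A))"
    and "dB = Gcd (insert n (set_mset B))"
  shows
    "regular \<Gamma> (length w) \<and>
     verts \<Gamma> = {Pos i | i. i < n} \<union> {Neg i | i. i < n} \<and>
     edges \<Gamma> = (\<Sum>i<n. {# Upair (Pos i) (Pos ((i + a) mod n)). a \<in># A #} +
                       {# Upair (Neg i) (Neg ((i + b) mod n)). b \<in># B #} +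
                       {# Upair (Pos i) (Neg ((i + q) mod n)). q \<in># Q #}) \<and>
     (\<not> alternating w \<longrightarrow>
       (\<forall>q0 d Gp Gm G.
          q0 \<in># Q \<longrightarrow>
          d = nat (Gcd ({int n} \<union> int ` set_mset A \<union> int ` set_mset B \<union>
                        {int q - int q0 | q. q \<in># Q})) \<longrightarrow>
          Gp = (\<lambda>j. induced \<Gamma> {Pos ((j + t * d) mod n) | t. t < n div d}) \<longrightarrow>
          Gm = (\<lambda>j. induced \<Gamma> {Neg ((j + q0 + t * d) mod n) | t. t < n div d}) \<longrightarrow>
          G = (\<lambda>j. induced \<Gamma> (verts (Gp j) \<union> verts (Gm j))) \<longrightarrow>
          components \<Gamma> = G ` {..<d} \<and> card (components \<Gamma>) = d \<and>
          (\<forall>j<d. \<forall>k<d. graph_isomorphic (G j) (G k)) \<and>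
          (\<forall>j<d. card (verts (Gp j)) = n div d \<and> card (verts (Gm j)) = n div d) \<and>
          (\<forall>C\<in>components \<Gamma>. \<forall>i k.
             (Pos i \<in> verts C \<and> Pos k \<in> verts C \<longrightarrow> [i = k] (mod d)) \<and>
             (Neg i \<in> verts C \<and> Neg k \<in> verts C \<longrightarrow> [i = k] (mod d))))) \<and>
     (alternating w \<longrightarrow>
       (\<forall>Gp Gm.
          Gp = (\<lambda>j. induced \<Gamma> {Pos ((j + t * dA) mod n) | t. t < n div dA}) \<longrightarrow>
          Gm = (\<lambda>j. induced \<Gamma> {Neg ((j + t * dB) mod n) | t. t < n div dB}) \<longrightarrow>
          components \<Gamma> = Gp ` {..<dA} \<union> Gm ` {..<dB} \<and>
          card (components \<Gamma>) = dA + dB \<and>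
          (\<forall>j<dA. graph_isomorphic (Gp j) (circulant (n div dA) {# a div dA. a \<in># A #})) \<and>
          (\<forall>j<dB. graph_isomorphic (Gm j) (circulant (n div dB) {# b div dB. b \<in># B #}))))"
proof -
  have letters: "set w \<subseteq> Pos ` {..<n} \<union> Neg ` {..<n}"
    using assms(2) by (auto simp: free_group_def)
  have n: "n > 0" using assms(1) by simp
  have verts: "verts \<Gamma> = Pos ` {..<n} \<union> Neg ` {..<n}"
    by (simp add: assms(7) star_graph_def)
  have edges: "edges \<Gamma> = star_edges n A B Q"
    unfolding assms(7-10) by (rule edges_star_graph_cyclic[OF assms(2,4-6)])
  \<comment> \<open>Positive and negative vertices have degrees given by different formulas; the
    count of cyclic pairs makes both equal to the length.\<close>
  have regular: "regular \<Gamma> (length w)"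
    using degree_star_edges[OF edges] size_offsets[of n w]
    by (auto simp: regular_def verts assms(8-10))
  have verts': "verts \<Gamma> = {Pos i | i. i < n} \<union> {Neg i | i. i < n}"
    by (auto simp: verts)
  have verts_induced: "verts (induced \<Gamma> U) = U" for U
    by (simp add: induced_def)
  have nonalternating: "components \<Gamma> = G ` {..<d} \<and> card (components \<Gamma>) = d \<and>
      (\<forall>j<d. \<forall>k<d. graph_isomorphic (G j) (G k)) \<and>
      (\<forall>j<d. card (verts (Gp j)) = n div d \<and> card (verts (Gm j)) = n div d) \<and>
      (\<forall>C\<in>components \<Gamma>. \<forall>i k.
         (Pos i \<in> verts C \<and> Pos k \<in> verts C \<longrightarrow> [i = k] (mod d)) \<and>
         (Neg i \<in> verts C \<and> Neg k \<in> verts C \<longrightarrow> [i = k] (mod d)))"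
    if q0: "q0 \<in># Q"
      and d: "d = nat (Gcd ({int n} \<union> int ` set_mset A \<union> int ` set_mset B \<union>
                            {int q - int q0 | q. q \<in># Q}))"
      and Gp: "Gp = (\<lambda>j. induced \<Gamma> {Pos ((j + t * d) mod n) | t. t < n div d})"
      and Gm: "Gm = (\<lambda>j. induced \<Gamma> {Neg ((j + q0 + t * d) mod n) | t. t < n div d})"
      and G: "G = (\<lambda>j. induced \<Gamma> (verts (Gp j) \<union> verts (Gm j)))"
    for q0 d Gp Gm G
  proof -
    define U where "U = (\<lambda>j. {Pos ((j + t * d) mod n) | t. t < n div d} \<union>
                            {Neg ((j + q0 + t * d) mod n) | t. t < n div d})"
    note comps = nonalternating_components[OF n verts edges q0 d U_def]
    have G_eq: "G = (\<lambda>j. induced \<Gamma> (U j))"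
      by (simp add: G Gp Gm U_def verts_induced)
    have cards: "card (verts (Gp j)) = n div d" "card (verts (Gm j)) = n div d" for j
      using card_residue_vertices[OF comps(1) n, of Pos] card_residue_vertices[OF comps(1) n, of Neg]
      by (simp_all add: Gp Gm verts_induced inj_def)
    have U_eq: "U j = Pos ` {i. i < n \<and> [i = j] (mod d)} \<union> Neg ` {i. i < n \<and> [i = j + q0] (mod d)}" for j
      unfolding U_def residue_vertices_eq[OF comps(1) n] ..
    have "(Pos i \<in> verts C \<and> Pos k \<in> verts C \<longrightarrow> [i = k] (mod d)) \<and>
        (Neg i \<in> verts C \<and> Neg k \<in> verts C \<longrightarrow> [i = k] (mod d))" if "C \<in> components \<Gamma>" for C i k
      using that unfolding comps(3) by (auto simp: verts_induced U_eq cong_def)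
    then show ?thesis
      using comps(3-5) cards unfolding G_eq by blast
  qed
  have alternating: "components \<Gamma> = Gp ` {..<dA} \<union> Gm ` {..<dB} \<and>
      card (components \<Gamma>) = dA + dB \<and>
      (\<forall>j<dA. graph_isomorphic (Gp j) (circulant (n div dA) {# a div dA. a \<in># A #})) \<and>
      (\<forall>j<dB. graph_isomorphic (Gm j) (circulant (n div dB) {# b div dB. b \<in># B #}))"
    if "alternating w"
      and Gp: "Gp = (\<lambda>j. induced \<Gamma> {Pos ((j + t * dA) mod n) | t. t < n div dA})"
      and Gm: "Gm = (\<lambda>j. induced \<Gamma> {Neg ((j + t * dB) mod n) | t. t < n div dB})"
    for Gp Gm
  proof -
    have "Q = {#}" using that(1) assms(10) alternating_iff_offsets_Q by simp
    then have "edges \<Gamma> = star_edges n A B {#}" using edges by simp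
    note comps = alternating_components[OF n verts this assms(11,12) refl refl]
    show ?thesis unfolding Gp Gm using comps by blast
  qed
  show ?thesis
  proof (rule conjI[OF regular], rule conjI[OF verts'],
      rule conjI[OF edges[unfolded star_edges_def]], rule conjI)
  qed ((intro allI impI, rule nonalternating; assumption),
      (intro allI impI, rule alternating; assumption))
qed

end
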